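(* Let $B$ be a finite graph without half-loops and let $\phi:\psi\to B$ be an étale morphism from a finite graph $\psi$; let $r=\mathrm{ord}(\psi)$. Then for large $n$, $$\mathbb E_{G\in\mathcal C_n(B)}[\mathrm{NumOccurs}(\phi,G)]=n^{-r}+O(n^{-r-1}),$$ and hence $\Pr_{G\in\mathcal C_n(B)}[\phi\text{ occurs in }G]\le n^{-r}+O(n^{-r-1})$. Furthermore, if $\psi$ is pruned and each connected component of $\psi$ has order at least one, then for large $n$ the probability that $\phi$ occurs at least once in $G\in\mathcal C_n(B)$ equals $n^{-r}/c+O(n^{-r-1})$, where $c=|\mathrm{Aut}(\phi)|$.
   Context: Graphs are finite with multiple edges and whole-loops allowed, no half-loops; $\mathrm{ord}(\psi)=|E_\psi|-|V_\psi|$; pruned means every vertex has degree at least two. A morphism is étale if it is injective on directed edges with a given tail and on those with a given head. $\mathcal C_n(B)$: random cover $\pi:G\to B$ with vertices $V_B\times[n]$ from independent uniform $\sigma(e)\in S_n$ per undirected edge ($\sigma(e^{-1})=\sigma(e)^{-1}$), the edge over $e$ from $(t(e),i)$ to $(h(e),\sigma(e)i)$. For $\phi:\psi\to B$, $\mathrm{NumOccurs}(\phi,G)$ is the number of injective graph morphisms $\nu:\psi\to G$ with $\pi\circ\nu=\phi$; $\phi$ occurs in $G$ if this number is positive. $\mathrm{Aut}(\phi)$ is the group of graph automorphisms $\nu$ of $\psi$ with $\phi\circ\nu=\phi$. *)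

theory Defs
  imports Main "HOL-Library.FuncSet" "HOL-Library.Landau_Symbols" "HOL-Combinatorics.Permutations"
begin

text \<open>A finite graph (multiple edges and whole-loops allowed, no half-loops) is given by
  a vertex set, a set of directed edges (darts), a tail map and a fixed-point-free
  involution reversing the direction of darts. An undirected edge is an orbit
  of size two of the involution; a whole-loop is a dart d with tail d = head d.\<close>

record ('v, 'd) graph =
  verts :: "'v set"
  darts :: "'d set"
  tail    :: "'d \<Rightarrow> 'v"
  rv    :: "'d \<Rightarrow> 'd"

definition head :: "('v, 'd) graph \<Rightarrow> 'd \<Rightarrow> 'v" where
  "head G d = tail G (rv G d)"

definition wf_graph :: "('v, 'd) graph \<Rightarrow> bool" where
  "wf_graph G \<longleftrightarrow> finite (verts G) \<and> finite (darts G)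
     \<and> (\<forall>d \<in> darts G. tail G d \<in> verts G \<and> rv G d \<in> darts G
                       \<and> rv G (rv G d) = d \<and> rv G d \<noteq> d)"

definition ord :: "('v, 'd) graph \<Rightarrow> int" where
  "ord G = int (card (darts G)) div 2 - int (card (verts G))"

definition degree :: "('v, 'd) graph \<Rightarrow> 'v \<Rightarrow> nat" where
  "degree G v = card {d \<in> darts G. tail G d = v}"

definition pruned :: "('v, 'd) graph \<Rightarrow> bool" where
  "pruned G \<longleftrightarrow> (\<forall>v \<in> verts G. degree G v \<ge> 2)"

definition adj :: "('v, 'd) graph \<Rightarrow> ('v \<times> 'v) set" where
  "adj G = {(tail G d, head G d) | d. d \<in> darts G}"

definition components :: "('v, 'd) graph \<Rightarrow> 'v set set" where
  "components G = {{w \<in> verts G. (v, w) \<in> (adj G)\<^sup>*} | v. v \<in> verts G}"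

definition comp_ord :: "('v, 'd) graph \<Rightarrow> 'v set \<Rightarrow> int" where
  "comp_ord G C = int (card {d \<in> darts G. tail G d \<in> C}) div 2 - int (card C)"

definition is_morphism :: "('v, 'd) graph \<Rightarrow> ('w, 'e) graph \<Rightarrow> ('v \<Rightarrow> 'w) \<Rightarrow> ('d \<Rightarrow> 'e) \<Rightarrow> bool" where
  "is_morphism G H fv fd \<longleftrightarrow>
     (\<forall>v \<in> verts G. fv v \<in> verts H) \<and>
     (\<forall>d \<in> darts G. fd d \<in> darts H \<and> tail H (fd d) = fv (tail G d) \<and> rv H (fd d) = fd (rv G d))"

definition etale :: "('v, 'd) graph \<Rightarrow> ('w, 'e) graph \<Rightarrow> ('v \<Rightarrow> 'w) \<Rightarrow> ('d \<Rightarrow> 'e) \<Rightarrow> bool" where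
  "etale G H fv fd \<longleftrightarrow> is_morphism G H fv fd \<and>
     (\<forall>v \<in> verts G. inj_on fd {d \<in> darts G. tail G d = v}) \<and>
     (\<forall>v \<in> verts G. inj_on fd {d \<in> darts G. head G d = v})"

text \<open>Permutation data of the random cover: for every dart e of B a permutation
  sigma(e) of [n] = {0..<n}, with sigma(e^{-1}) = sigma(e)^{-1}.  Uniform choice from this
  finite set is the same as independent uniform choices for each undirected edge.\<close>
definition cover_perms :: "('v, 'd) graph \<Rightarrow> nat \<Rightarrow> ('d \<Rightarrow> nat \<Rightarrow> nat) set" where
  "cover_perms B n = {\<sigma>. (\<forall>e \<in> darts B. \<sigma> e permutes {..<n} \<and> \<sigma> (rv B e) = inv (\<sigma> e))
                         \<and> (\<forall>e. e \<notin> darts B \<longrightarrow> \<sigma> e = id)}"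

text \<open>The cover G: vertices V_B x [n]; the dart over e with index i goes from
  (t(e), i) to (h(e), sigma(e) i). Its reverse is the dart over e^{-1} with index sigma(e) i.\<close>
definition cover_graph :: "('v, 'd) graph \<Rightarrow> nat \<Rightarrow> ('d \<Rightarrow> nat \<Rightarrow> nat) \<Rightarrow> ('v \<times> nat, 'd \<times> nat) graph" where
  "cover_graph B n \<sigma> = \<lparr> verts = verts B \<times> {..<n}, darts = darts B \<times> {..<n},
      tail = (\<lambda>(e, i). (tail B e, i)), rv = (\<lambda>(e, i). (rv B e, \<sigma> e i)) \<rparr>"

definition num_occurs :: "('w, 'e) graph \<Rightarrow> ('w \<Rightarrow> 'v) \<Rightarrow> ('e \<Rightarrow> 'd) \<Rightarrow> ('v \<times> nat, 'd \<times> nat) graph \<Rightarrow> nat" where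
  "num_occurs \<psi> \<phi>V \<phi>D G = card {(fv, fd).
      fv \<in> verts \<psi> \<rightarrow>\<^sub>E verts G \<and> fd \<in> darts \<psi> \<rightarrow>\<^sub>E darts G \<and>
      is_morphism \<psi> G fv fd \<and> inj_on fv (verts \<psi>) \<and> inj_on fd (darts \<psi>) \<and>
      (\<forall>v \<in> verts \<psi>. fst (fv v) = \<phi>V v) \<and> (\<forall>d \<in> darts \<psi>. fst (fd d) = \<phi>D d)}"

definition aut :: "('w, 'e) graph \<Rightarrow> ('w \<Rightarrow> 'v) \<Rightarrow> ('e \<Rightarrow> 'd) \<Rightarrow> (('w \<Rightarrow> 'w) \<times> ('e \<Rightarrow> 'e)) set" where
  "aut \<psi> \<phi>V \<phi>D = {(fv, fd).
      fv \<in> verts \<psi> \<rightarrow>\<^sub>E verts \<psi> \<and> fd \<in> darts \<psi> \<rightarrow>\<^sub>E darts \<psi> \<and>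
      is_morphism \<psi> \<psi> fv fd \<and> bij_betw fv (verts \<psi>) (verts \<psi>) \<and> bij_betw fd (darts \<psi>) (darts \<psi>) \<and>
      (\<forall>v \<in> verts \<psi>. \<phi>V (fv v) = \<phi>V v) \<and> (\<forall>d \<in> darts \<psi>. \<phi>D (fd d) = \<phi>D d)}"

definition expected_occurs :: "('v, 'd) graph \<Rightarrow> ('w, 'e) graph \<Rightarrow> ('w \<Rightarrow> 'v) \<Rightarrow> ('e \<Rightarrow> 'd) \<Rightarrow> nat \<Rightarrow> real" where
  "expected_occurs B \<psi> \<phi>V \<phi>D n =
     (\<Sum>\<sigma> \<in> cover_perms B n. real (num_occurs \<psi> \<phi>V \<phi>D (cover_graph B n \<sigma>)))
       / real (card (cover_perms B n))"

definition prob_occurs :: "('v, 'd) graph \<Rightarrow> ('w, 'e) graph \<Rightarrow> ('w \<Rightarrow> 'v) \<Rightarrow> ('e \<Rightarrow> 'd) \<Rightarrow> nat \<Rightarrow> real" where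
  "prob_occurs B \<psi> \<phi>V \<phi>D n =
     real (card {\<sigma> \<in> cover_perms B n. num_occurs \<psi> \<phi>V \<phi>D (cover_graph B n \<sigma>) > 0})
       / real (card (cover_perms B n))"

end

theory Submission
  imports Defs
begin

text \<open>An occurrence of \<open>\<phi>\<close> amounts to a labelling \<open>a : V\<^sub>\<psi> \<rightarrow> [n]\<close>, injective on the fibres of \<open>\<phi>\<close>,
  such that the permutation over \<open>\<phi> d\<close> sends \<open>a (tail d)\<close> to \<open>a (head d)\<close> for every dart \<open>d\<close>.
  There are \<open>n\<^bsup>|V|\<^esup> (1 + O(1/n))\<close> such labellings, and each is realised with probability
  \<open>n\<^bsup>-|E|\<^esup> (1 + O(1/n))\<close>; summing gives the expectation, and Markov's inequality the upper bound.

  For the last part let \<open>X\<close> be the number of occurrences and \<open>N\<close> the number of pairs of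
  occurrences with different images. The occurrences with a given image form a torsor under
  \<open>Aut(\<phi>)\<close>, so \<open>X\<^sup>2 = c X + N\<close> and \<open>0 \<le> X - c [X > 0] \<le> N\<close>. It remains to see that
  \<open>E[N] = O(n\<^bsup>-r-1\<^esup>)\<close>: the overlap of two different images is a proper subgraph of \<open>\<psi>\<close>, and degree
  counting shows that a proper subgraph of a pruned graph with all components of order at least one
  misses more edges than vertices, so the union of the two images has order at least \<open>r + 1\<close>.\<close>

section \<open>Permutations extending a partial injection\<close>

text \<open>The complements of \<open>I\<close> and of its image under \<open>g\<close> have equal
  size, so any bijection \<open>h\<close> between them completes \<open>g\<close>; off
  \<open>S\<close> the identity is forced.\<close>

lemma permutes_extension_exists:
  assumes "finite S" "I \<subseteq> S" "inj_on g I" "g ` I \<subseteq> S"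
  obtains q where "q permutes S" "\<And>i. i \<in> I \<Longrightarrow> q i = g i"
proof -
  have "card (S - I) = card (S - g ` I)"
    using assms by (simp add: card_Diff_subset finite_subset card_image)
  then obtain h where h: "bij_betw h (S - I) (S - g ` I)"
    using assms(1) finite_same_card_bij by blast
  define q where "q x = (if x \<in> I then g x else if x \<in> S then h x else x)" for x
  have "bij_betw q I (g ` I)"
    using assms(3) by (simp add: bij_betw_def q_def inj_on_def)
  moreover have "bij_betw q (S - I) (S - g ` I)"
    using h by (rule bij_betw_cong[THEN iffD1, rotated]) (auto simp: q_def)
  ultimately have "bij_betw q (I \<union> (S - I)) (g ` I \<union> (S - g ` I))"
    by (rule bij_betw_combine) auto
  then have "bij_betw q S S"
    using assms by (simp add: Un_absorb1)
  then have "q permutes S"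
    by (rule bij_imp_permutes) (use assms(2) in \<open>auto simp: q_def\<close>)
  then show ?thesis
    using that by (simp add: q_def)
qed

text \<open>Composition with one extension \<open>q\<close> carries the permutations of
  \<open>S - I\<close>, which are those of \<open>S\<close> that fix \<open>I\<close> pointwise,
  bijectively onto all the extensions of \<open>g\<close>.\<close>

lemma card_permutes_extending:
  assumes "finite S" "I \<subseteq> S" "inj_on g I" "g ` I \<subseteq> S"
  shows "card {p. p permutes S \<and> (\<forall>i\<in>I. p i = g i)} = fact (card S - card I)"
proof -
  obtain q where q: "q permutes S" "\<And>i. i \<in> I \<Longrightarrow> q i = g i"
    using permutes_extension_exists[OF assms] by blast
  have fix_iff: "p permutes (S - I) \<longleftrightarrow> p permutes S \<and> (\<forall>i\<in>I. p i = i)" for p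
    using assms(2) permutes_superset[of p S "S - I"] permutes_subset[of p "S - I" S]
      permutes_not_in[of p "S - I"] by auto
  have "bij_betw (\<lambda>p. q \<circ> p) {p. p permutes (S - I)} {p. p permutes S \<and> (\<forall>i\<in>I. p i = g i)}"
  proof (rule bij_betw_byWitness[where f' = "\<lambda>p. inv q \<circ> p"])
    show "\<forall>p\<in>{p. p permutes (S - I)}. inv q \<circ> (q \<circ> p) = p"
      using q(1) by (simp add: comp_assoc[symmetric] permutes_inv_o)
    show "\<forall>p\<in>{p. p permutes S \<and> (\<forall>i\<in>I. p i = g i)}. q \<circ> (inv q \<circ> p) = p"
      using q(1) by (simp add: comp_assoc[symmetric] permutes_inv_o)
    show "(\<lambda>p. q \<circ> p) ` {p. p permutes (S - I)} \<subseteq> {p. p permutes S \<and> (\<forall>i\<in>I. p i = g i)}"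
      using q by (auto simp: fix_iff intro: permutes_compose)
    show "(\<lambda>p. inv q \<circ> p) ` {p. p permutes S \<and> (\<forall>i\<in>I. p i = g i)} \<subseteq> {p. p permutes (S - I)}"
    proof safe
      fix p assume p: "p permutes S" "\<forall>i\<in>I. p i = g i"
      have "(inv q \<circ> p) permutes S"
        using p(1) q(1) by (simp add: permutes_compose permutes_inv)
      moreover have "(inv q \<circ> p) i = i" if "i \<in> I" for i
        using that p(2) q by (metis comp_apply permutes_inverses(2))
      ultimately show "inv q \<circ> p permutes (S - I)"
        by (simp add: fix_iff)
    qed
  qed
  then have "card {p. p permutes S \<and> (\<forall>i\<in>I. p i = g i)} = card {p. p permutes (S - I)}"
    by (simp add: bij_betw_same_card)
  also have "\<dots> = fact (card S - card I)"
    using assms by (simp add: card_permutations card_Diff_subset finite_subset)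
  finally show ?thesis .
qed

text \<open>Both single-valuedness hypotheses together make \<open>R\<close> the graph of an
  injective partial map, so exactly \<open>card R\<close> values are prescribed.\<close>

lemma card_permutes_extending_rel:
  assumes "finite S" "R \<subseteq> S \<times> S" "single_valued R" "single_valued (R\<inverse>)"
  shows "card {p. p permutes S \<and> (\<forall>(i, j)\<in>R. p i = j)} = fact (card S - card R)"
    and "card R \<le> card S"
proof -
  have inj: "inj_on fst R"
    using assms(3) by (auto simp: inj_on_def single_valued_def)
  define g where "g i = (THE j. (i, j) \<in> R)" for i
  have g: "g i = j" if "(i, j) \<in> R" for i j
    unfolding g_def using that assms(3) by (auto simp: single_valued_def)
  have "{p. p permutes S \<and> (\<forall>(i, j)\<in>R. p i = j)} = {p. p permutes S \<and> (\<forall>i\<in>fst ` R. p i = g i)}"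
    using g by force
  moreover have "inj_on g (fst ` R)"
    using assms(4) g by (fastforce simp: inj_on_def single_valued_def)
  moreover have "fst ` R \<subseteq> S" "g ` fst ` R \<subseteq> S"
    using assms(2) g by auto
  ultimately show "card {p. p permutes S \<and> (\<forall>(i, j)\<in>R. p i = j)} = fact (card S - card R)"
    using card_permutes_extending[OF assms(1), of "fst ` R" g] card_image[OF inj] by simp
  show "card R \<le> card S"
    using card_mono[OF assms(1) \<open>fst ` R \<subseteq> S\<close>] card_image[OF inj] by simp
qed

section \<open>Estimates for falling factorials and powers\<close>

lemma fact_le_power_mult_fact:
  assumes "k \<le> n"
  shows "fact n \<le> n ^ k * (fact (n - k) :: nat)"
  using assms
proof (induction k)
  case (Suc k)
  then have "fact (n - k) = (n - k) * (fact (n - Suc k) :: nat)"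
    by (metis Suc_diff_Suc Suc_le_lessD fact_Suc of_nat_id)
  also have "\<dots> \<le> n * fact (n - Suc k)"
    by (intro mult_right_mono) auto
  finally have "n ^ k * fact (n - k) \<le> n ^ k * (n * (fact (n - Suc k) :: nat))"
    by (rule mult_left_mono) simp
  also have "\<dots> = n ^ Suc k * fact (n - Suc k)"
    by (simp add: mult.assoc mult.left_commute)
  finally show ?case
    using Suc by (meson Suc_leD le_trans)
qed simp

text \<open>Each of the \<open>k\<close> factors of the falling factorial exceeds
  \<open>n - k\<close>, hence \<open>n - m\<close>. The base involves a common \<open>m\<close>
  instead of \<open>k\<close> so that the bounds for different edges of \<open>B\<close> multiply to
  a single power.\<close>

lemma power_mult_fact_le_fact:
  assumes "k \<le> m" "k \<le> n"
  shows "(n - m) ^ k * (fact (n - k) :: nat) \<le> fact n"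
  using assms
proof (induction k)
  case (Suc k)
  then have eq: "fact (n - k) = (n - k) * (fact (n - Suc k) :: nat)"
    by (metis Suc_diff_Suc Suc_le_lessD fact_Suc of_nat_id)
  have "(n - m) * (fact (n - Suc k) :: nat) \<le> fact (n - k)"
    unfolding eq using Suc.prems by (intro mult_right_mono) auto
  then have "(n - m) ^ k * ((n - m) * (fact (n - Suc k) :: nat)) \<le> (n - m) ^ k * fact (n - k)"
    by (rule mult_left_mono) simp
  then have "(n - m) ^ Suc k * (fact (n - Suc k) :: nat) \<le> (n - m) ^ k * fact (n - k)"
    by (simp add: mult.assoc mult.left_commute)
  then show ?case
    using Suc by (meson Suc_leD le_trans)
qed simp

text \<open>Bernoulli's inequality for \<open>(1 - m/n)^m\<close>, scaled by
  \<open>n^m\<close>.\<close>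

lemma diff_power_ge:
  assumes "m \<le> n" "n > 0"
  shows "real n ^ m * (1 - real m ^ 2 / real n) \<le> (real n - real m) ^ m"
proof -
  have "1 + real m * (- (real m / real n)) \<le> (1 + (- (real m / real n))) ^ m"
    by (rule Bernoulli_inequality) (use assms in simp)
  then have "real n ^ m * (1 - real m ^ 2 / real n) \<le> real n ^ m * (1 - real m / real n) ^ m"
    by (intro mult_left_mono) (simp_all add: power2_eq_square)
  also have "\<dots> = (real n * (1 - real m / real n)) ^ m"
    by (simp add: power_mult_distrib)
  also have "real n * (1 - real m / real n) = real n - real m"
    using assms by (simp add: field_simps)
  finally show ?thesis .
qed

text \<open>The hypothesis makes \<open>x = m^2/n\<close> smaller than 1/2, and there
  \<open>1/(1 - x) \<le> 1 + 2 * x\<close>.\<close>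

lemma inverse_diff_power_le:
  assumes "n > 2 * m ^ 2"
  shows "1 / (real n - real m) ^ m \<le> (1 + 2 * real m ^ 2 / real n) / real n ^ m"
proof -
  define x where "x = real m ^ 2 / real n"
  have "real (2 * m ^ 2) < real n"
    using assms by (simp only: of_nat_less_iff)
  moreover have n: "n > 0"
    using assms by simp
  ultimately have x: "0 \<le> x" "x < 1 / 2"
    by (auto simp: x_def field_simps)
  have "m \<le> m ^ 2"
    by (cases m) (auto simp: power2_eq_square)
  then have "m \<le> n"
    using assms by simp
  then have "real n ^ m * (1 - x) \<le> (real n - real m) ^ m"
    using diff_power_ge[of m n] n by (simp add: x_def)
  moreover have "0 < real n ^ m * (1 - x)"
    using x n by simp
  ultimately have "1 / (real n - real m) ^ m \<le> 1 / (real n ^ m * (1 - x))"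
    by (intro frac_le) (assumption | simp)+
  also have "\<dots> = (1 / (1 - x)) / real n ^ m"
    by simp
  also have "\<dots> \<le> (1 + 2 * x) / real n ^ m"
  proof (rule divide_right_mono)
    have "x * (2 * x) \<le> x * 1"
      using x by (intro mult_left_mono) auto
    then have "1 \<le> (1 + 2 * x) * (1 - x)"
      by (simp add: algebra_simps)
    then show "1 / (1 - x) \<le> 1 + 2 * x"
      using x by (simp add: divide_le_eq)
  qed simp
  finally show ?thesis
    by (simp add: x_def)
qed

section \<open>Random covers satisfying prescribed constraints\<close>

text \<open>\<open>P\<close> picks one dart from each undirected edge. Over \<open>P\<close> the
  permutations of a random cover are independent, which turns counts of covers into
  products.\<close>

lemma wf_graph_orientation:
  assumes "wf_graph G"
  obtains P where "P \<inter> rv G ` P = {}" "P \<union> rv G ` P = darts G"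
proof -
  \<comment> \<open>The choice depends only on the unordered pair, so a dart and its reverse select
    the same representative.\<close>
  define ch where "ch d = (SOME x. x \<in> {d, rv G d})" for d
  have rv: "rv G d \<in> darts G" "rv G (rv G d) = d" "rv G d \<noteq> d" if "d \<in> darts G" for d
    using assms that by (auto simp: wf_graph_def)
  have ch: "ch d = d \<or> ch d = rv G d" for d
    unfolding ch_def using someI[of "\<lambda>x. x \<in> {d, rv G d}" d] by auto
  have ch_rv: "ch (rv G d) = ch d" if "d \<in> darts G" for d
    unfolding ch_def using rv[OF that] by (simp add: insert_commute)
  define P where "P = {d \<in> darts G. ch d = d}"
  have "P \<inter> rv G ` P = {}"
    using ch_rv rv by (auto simp: P_def) metis
  moreover have "P \<union> rv G ` P = darts G"
  proof
    show "P \<union> rv G ` P \<subseteq> darts G"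
      using rv by (auto simp: P_def)
    show "darts G \<subseteq> P \<union> rv G ` P"
    proof
      fix d assume d: "d \<in> darts G"
      show "d \<in> P \<union> rv G ` P"
      proof (cases "ch d = d")
        case False
        then have "rv G d \<in> P"
          using ch[of d] ch_rv[OF d] rv[OF d] by (simp add: P_def)
        then show ?thesis
          using rv[OF d] by (metis UnI2 image_eqI)
      qed (use d in \<open>simp add: P_def\<close>)
    qed
  qed
  ultimately show ?thesis
    using that by blast
qed

text \<open>Darts come in pairs, so halving their number, as in \<open>ord\<close>, is
  exact.\<close>

lemma wf_graph_even_darts:
  assumes "wf_graph G"
  shows "even (card (darts G))"
proof -
  obtain P where P: "P \<inter> rv G ` P = {}" "P \<union> rv G ` P = darts G"
    using wf_graph_orientation[OF assms] by blast
  have "inj_on (rv G) P"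
    using P(2) assms by (metis Un_iff inj_onI wf_graph_def)
  then have "card (darts G) = card P + card P"
    using P assms by (metis card_Un_disjoint card_image finite_Un wf_graph_def)
  then show ?thesis
    by simp
qed

text \<open>The permutations over \<open>P\<close> may be chosen freely; those over reversed darts
  are their inverses, and \<open>id\<close> is the fixed value off \<open>darts B\<close>.
  Hypothesis \<open>A\<close> makes a condition imposed over \<open>P\<close> carry over to the
  reversed darts.\<close>

lemma bij_betw_cover_perms_orientation:
  assumes "wf_graph B" and P: "P \<inter> rv B ` P = {}" "P \<union> rv B ` P = darts B"
    and A: "\<And>e p. e \<in> darts B \<Longrightarrow> p permutes {..<n} \<Longrightarrow> A e p \<Longrightarrow> A (rv B e) (inv p)"
  shows "bij_betw (\<lambda>\<sigma>. restrict \<sigma> P) {\<sigma> \<in> cover_perms B n. \<forall>e\<in>darts B. A e (\<sigma> e)}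
           (\<Pi>\<^sub>E e\<in>P. {p. p permutes {..<n} \<and> A e p})"
proof (rule bij_betw_byWitness[where
      f' = "\<lambda>f e. if e \<in> P then f e else if e \<in> darts B then inv (f (rv B e)) else id"])
  have rv: "rv B d \<in> darts B" "rv B (rv B d) = d" "rv B d \<noteq> d" if "d \<in> darts B" for d
    using assms that by (auto simp: wf_graph_def)
  have PD: "e \<in> darts B" if "e \<in> P" for e
    using that P by auto
  have rvP: "rv B e \<in> P \<longleftrightarrow> e \<notin> P" if "e \<in> darts B" for e
  proof
    assume "rv B e \<in> P"
    then have "e \<in> rv B ` P"
      using rv(2)[OF that] by (metis imageI)
    then show "e \<notin> P"
      using P(1) by blast
  next
    assume "e \<notin> P"
    moreover have "e \<in> P \<union> rv B ` P"
      using that by (simp only: P(2))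
    ultimately have "e \<in> rv B ` P"
      by simp
    then obtain x where "x \<in> P" "e = rv B x"
      by (elim imageE)
    then show "rv B e \<in> P"
      using rv(2)[OF PD] by simp
  qed
  let ?g = "\<lambda>f e. if e \<in> P then f e else if e \<in> darts B then inv (f (rv B e)) else id"
  let ?X = "{\<sigma> \<in> cover_perms B n. \<forall>e\<in>darts B. A e (\<sigma> e)}"
  let ?Y = "\<Pi>\<^sub>E e\<in>P. {p. p permutes {..<n} \<and> A e p}"
  show "\<forall>\<sigma>\<in>?X. ?g (restrict \<sigma> P) = \<sigma>"
  proof
    fix \<sigma> assume s: "\<sigma> \<in> ?X"
    show "?g (restrict \<sigma> P) = \<sigma>"
    proof
      fix e
      show "?g (restrict \<sigma> P) e = \<sigma> e"
        using s rvP[of e] rv[of e] by (auto simp: cover_perms_def) (metis permutes_inv_inv)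
    qed
  qed
  show "\<forall>f\<in>?Y. restrict (?g f) P = f"
  proof
    fix f assume "f \<in> ?Y"
    then show "restrict (?g f) P = f"
      by (intro ext) (auto simp: PiE_def extensional_def)
  qed
  show "(\<lambda>\<sigma>. restrict \<sigma> P) ` ?X \<subseteq> ?Y"
    using PD by (auto simp: cover_perms_def)
  show "?g ` ?Y \<subseteq> ?X"
  proof
    fix \<sigma> assume "\<sigma> \<in> ?g ` ?Y"
    then obtain f where f: "f \<in> ?Y" "\<sigma> = ?g f"
      by blast
    have perm: "f e permutes {..<n}" "A e (f e)" if "e \<in> P" for e
      using f(1) that by auto
    have "\<sigma> e permutes {..<n} \<and> \<sigma> (rv B e) = inv (\<sigma> e) \<and> A e (\<sigma> e)" if e: "e \<in> darts B" for e
    proof (cases "e \<in> P")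
      case True
      then show ?thesis
        using f(2) perm rvP[OF e] rv[OF e] by simp
    next
      case False
      then have r: "rv B e \<in> P"
        using rvP[OF e] by simp
      then show ?thesis
        using f(2) perm[OF r] False e rv[OF e] A[OF rv(1)[OF e] perm[OF r]]
        by (simp add: permutes_inv permutes_inv_inv)
    qed
    moreover have "\<sigma> e = id" if "e \<notin> darts B" for e
      using that f(2) PD by auto
    ultimately show "\<sigma> \<in> ?X"
      by (simp add: cover_perms_def)
  qed
qed

text \<open>A triple \<open>(e, i, j)\<close> stands for a dart of the cover over \<open>e\<close>
  that joins index \<open>i\<close> to index \<open>j\<close>. Thus \<open>C\<close> describes a
  partial cover, and the set consists of the covers that contain it.\<close>

definition satisfying :: "('v, 'd) graph \<Rightarrow> nat \<Rightarrow> ('d \<times> nat \<times> nat) set \<Rightarrow> ('d \<Rightarrow> nat \<Rightarrow> nat) set" where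
  "satisfying B n C = {\<sigma> \<in> cover_perms B n. \<forall>(e, i, j)\<in>C. \<sigma> e i = j}"

lemma in_satisfying_iff:
  "\<sigma> \<in> satisfying B n C \<longleftrightarrow> \<sigma> \<in> cover_perms B n \<and> (\<forall>e i j. (e, i, j) \<in> C \<longrightarrow> \<sigma> e i = j)"
  by (auto simp: satisfying_def)

text \<open>The choices over \<open>P\<close> are independent, and over each \<open>e\<close> the
  permutation has to extend the partial injection that \<open>C\<close> prescribes there. Both darts
  of an edge carry equally many triples, whence the factor 2.\<close>

lemma card_satisfying_orientation:
  assumes "wf_graph B" and P: "P \<inter> rv B ` P = {}" "P \<union> rv B ` P = darts B"
    and C: "C \<subseteq> darts B \<times> {..<n} \<times> {..<n}"
    and swap: "\<And>e i j. (e, i, j) \<in> C \<Longrightarrow> (rv B e, j, i) \<in> C"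
    and fn: "\<And>e i j j'. (e, i, j) \<in> C \<Longrightarrow> (e, i, j') \<in> C \<Longrightarrow> j = j'"
  shows "card (satisfying B n C) = (\<Prod>e\<in>P. fact (n - card (C `` {e})))"
    and "\<And>e. e \<in> P \<Longrightarrow> card (C `` {e}) \<le> n"
    and "card C = 2 * (\<Sum>e\<in>P. card (C `` {e}))"
proof -
  have rv: "rv B d \<in> darts B" "rv B (rv B d) = d" "rv B d \<noteq> d" if "d \<in> darts B" for d
    using assms that by (auto simp: wf_graph_def)
  have finD: "finite (darts B)"
    using assms(1) by (simp add: wf_graph_def)
  then have finP: "finite P"
    using P by (metis finite_Un)
  have C_rv: "C `` {rv B e} = (C `` {e})\<inverse>" if "e \<in> darts B" for e
    using swap swap[of "rv B e"] rv(2)[OF that] by auto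
  have sub: "C `` {e} \<subseteq> {..<n} \<times> {..<n}" for e
    using C by auto
  have sv: "single_valued (C `` {e})" for e
    using fn by (auto simp: single_valued_def)
  \<comment> \<open>Injectivity over \<open>e\<close> is functionality over \<open>rv B e\<close>,
    because \<open>C\<close> is closed under reversal.\<close>
  have sv': "single_valued ((C `` {e})\<inverse>)" if "e \<in> darts B" for e
    using sv C_rv[OF that] by metis
  let ?A = "\<lambda>e p. \<forall>(i, j)\<in>C `` {e}. p i = j"
  have "satisfying B n C = {\<sigma> \<in> cover_perms B n. \<forall>e\<in>darts B. ?A e (\<sigma> e)}"
  proof -
    have "e \<in> darts B" if "(e, i, j) \<in> C" for e i j
      using C that by blast
    then show ?thesis
      unfolding satisfying_def by (auto split: prod.splits)
  qed
  moreover have "?A (rv B e) (inv p)" if "e \<in> darts B" "p permutes {..<n}" "?A e p" for e p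
  proof -
    have "inv p j = i" if "(e, i, j) \<in> C" for i j
    proof -
      have "p i = j"
        using bspec[OF \<open>?A e p\<close>, of "(i, j)"] that by simp
      then show ?thesis
        using permutes_inverses(2)[OF \<open>p permutes {..<n}\<close>, of i] by simp
    qed
    then show ?thesis
      by (auto simp: C_rv[OF that(1)])
  qed
  ultimately have "bij_betw (\<lambda>\<sigma>. restrict \<sigma> P) (satisfying B n C) (\<Pi>\<^sub>E e\<in>P. {p. p permutes {..<n} \<and> ?A e p})"
    using bij_betw_cover_perms_orientation[OF assms(1) P, of n ?A] by simp
  then have "card (satisfying B n C) = card (\<Pi>\<^sub>E e\<in>P. {p. p permutes {..<n} \<and> ?A e p})"
    by (rule bij_betw_same_card)
  also have "\<dots> = (\<Prod>e\<in>P. card {p. p permutes {..<n} \<and> ?A e p})"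
    using finP by (simp add: card_PiE)
  also have "\<dots> = (\<Prod>e\<in>P. fact (n - card (C `` {e})))"
    using card_permutes_extending_rel(1)[of "{..<n}", OF _ sub sv sv'] P
    by (intro prod.cong) auto
  finally show "card (satisfying B n C) = (\<Prod>e\<in>P. fact (n - card (C `` {e})))" .
  show "card (C `` {e}) \<le> n" if "e \<in> P" for e
    using card_permutes_extending_rel(2)[of "{..<n}", OF _ sub sv sv'] P that by auto
  have inj: "inj_on (rv B) P"
    using P(2) rv(2) by (metis Un_iff inj_onI)
  have "C = (SIGMA e:darts B. C `` {e})"
    using C by auto
  then have "card C = (\<Sum>e\<in>darts B. card (C `` {e}))"
    using finD sub by (metis card_SigmaI finite_SigmaI finite_lessThan finite_subset)
  also have "\<dots> = (\<Sum>e\<in>P. card (C `` {e})) + (\<Sum>e\<in>rv B ` P. card (C `` {e}))"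
    using finP P by (metis finite_imageI sum.union_disjoint)
  also have "(\<Sum>e\<in>rv B ` P. card (C `` {e})) = (\<Sum>e\<in>P. card (C `` {e}))"
  proof -
    have "card (C `` {rv B e}) = card (C `` {e})" if "e \<in> P" for e
    proof -
      have "e \<in> darts B"
        using P(2) that by blast
      then show ?thesis
        by (simp add: C_rv)
    qed
    then show ?thesis
      using inj by (simp add: sum.reindex)
  qed
  finally show "card C = 2 * (\<Sum>e\<in>P. card (C `` {e}))"
    by simp
qed

lemma card_cover_perms_pos:
  assumes "wf_graph B"
  shows "card (cover_perms B n) > 0" "finite (cover_perms B n)"
proof -
  obtain P where P: "P \<inter> rv B ` P = {}" "P \<union> rv B ` P = darts B"
    using wf_graph_orientation[OF assms] by blast
  have "card (satisfying B n {}) > 0"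
    using card_satisfying_orientation(1)[OF assms P, of "{}" n] by (simp add: prod_pos)
  then show "card (cover_perms B n) > 0"
    by (simp add: satisfying_def)
  then show "finite (cover_perms B n)"
    by (simp add: card_gt_0_iff)
qed

text \<open>Here \<open>m\<close> counts prescribed undirected edges, so the probability of
  satisfying \<open>C\<close> lies between \<open>1/n^m\<close> and \<open>1/(n - m)^m\<close>. The
  bound from above is stated for contradictory \<open>C\<close> as well, since the constraints of
  two labellings may conflict.\<close>

lemma card_satisfying_bounds:
  assumes "wf_graph B"
    and C: "C \<subseteq> darts B \<times> {..<n} \<times> {..<n}"
    and swap: "\<And>e i j. (e, i, j) \<in> C \<Longrightarrow> (rv B e, j, i) \<in> C"
    and cardC: "card C = 2 * m"
  shows "(n - m) ^ m * card (satisfying B n C) \<le> card (cover_perms B n)"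
    and "(\<And>e i j j'. (e, i, j) \<in> C \<Longrightarrow> (e, i, j') \<in> C \<Longrightarrow> j = j') \<Longrightarrow>
           card (cover_perms B n) \<le> n ^ m * card (satisfying B n C)"
proof -
  obtain P where P: "P \<inter> rv B ` P = {}" "P \<union> rv B ` P = darts B"
    using wf_graph_orientation[OF assms(1)] by blast
  have finP: "finite P"
    using P assms(1) by (metis finite_Un wf_graph_def)
  have tot: "card (cover_perms B n) = (\<Prod>e\<in>P. fact n)"
    using card_satisfying_orientation(1)[OF assms(1) P, of "{}" n] by (simp add: satisfying_def)
  let ?k = "\<lambda>e. card (C `` {e})"
  have upper: "card (cover_perms B n) \<le> n ^ m * card (satisfying B n C)"
    and lower: "(n - m) ^ m * card (satisfying B n C) \<le> card (cover_perms B n)"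
    if fn: "\<And>e i j j'. (e, i, j) \<in> C \<Longrightarrow> (e, i, j') \<in> C \<Longrightarrow> j = j'"
  proof -
    note * = card_satisfying_orientation[OF assms(1) P C swap fn]
    have m: "m = (\<Sum>e\<in>P. ?k e)"
      using *(3) cardC by simp
    have km: "?k e \<le> m" if "e \<in> P" for e
      unfolding m using finP that by (intro member_le_sum) auto
    have "(\<Prod>e\<in>P. fact n) \<le> (\<Prod>e\<in>P. n ^ ?k e * (fact (n - ?k e) :: nat))"
      by (intro prod_mono) (use *(2) fact_le_power_mult_fact in auto)
    then show "card (cover_perms B n) \<le> n ^ m * card (satisfying B n C)"
      by (simp add: tot *(1) prod.distrib m power_sum)
    have "(\<Prod>e\<in>P. (n - m) ^ ?k e * (fact (n - ?k e) :: nat)) \<le> (\<Prod>e\<in>P. fact n)"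
      by (intro prod_mono) (use *(2) km power_mult_fact_le_fact in auto)
    then have "(n - m) ^ (\<Sum>e\<in>P. ?k e) * (\<Prod>e\<in>P. fact (n - ?k e)) \<le> (\<Prod>e\<in>P. fact n)"
      by (simp add: prod.distrib power_sum)
    then show "(n - m) ^ m * card (satisfying B n C) \<le> card (cover_perms B n)"
      by (simp add: tot *(1) m)
  qed
  show "(\<And>e i j j'. (e, i, j) \<in> C \<Longrightarrow> (e, i, j') \<in> C \<Longrightarrow> j = j') \<Longrightarrow>
           card (cover_perms B n) \<le> n ^ m * card (satisfying B n C)"
    by (rule upper)
  show "(n - m) ^ m * card (satisfying B n C) \<le> card (cover_perms B n)"
  \<comment> \<open>If some cover satisfies \<open>C\<close>, its permutations witness that
    \<open>C\<close> is functional; otherwise the left-hand side is zero.\<close>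
  proof (cases "satisfying B n C = {}")
    case False
    then obtain \<sigma> where "\<sigma> \<in> satisfying B n C"
      by blast
    then show ?thesis
      by (intro lower) (metis in_satisfying_iff)
  qed simp
qed

section \<open>Proper subgraphs of pruned graphs\<close>

text \<open>All darts with tail outside \<open>Q\<close> are missing from \<open>D\<close>, and there are at least two per vertex.
  Equality would make the complement of \<open>Q\<close> a union of components in which every degree is two.\<close>

lemma pruned_subgraph_deficit:
  assumes wf: "wf_graph G" and "pruned G" and comp: "\<And>C. C \<in> components G \<Longrightarrow> comp_ord G C \<ge> 1"
    and Q: "Q \<subseteq> verts G" and D: "D \<subseteq> darts G"
    and Dr: "\<And>d. d \<in> D \<Longrightarrow> rv G d \<in> D" and Dt: "\<And>d. d \<in> D \<Longrightarrow> tail G d \<in> Q"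
    and ne: "\<not> (Q = verts G \<and> D = darts G)"
  shows "2 * card (verts G - Q) < card (darts G - D)"
proof -
  let ?W = "verts G - Q" and ?F = "darts G - D"
  have fin: "finite (verts G)" "finite (darts G)"
    and G: "\<And>d. d \<in> darts G \<Longrightarrow> tail G d \<in> verts G \<and> rv G d \<in> darts G \<and> rv G (rv G d) = d"
    using wf by (auto simp: wf_graph_def)
  have card_tail: "card {d \<in> darts G. tail G d \<in> S} = (\<Sum>v\<in>S. degree G v)" if "finite S" for S
  proof -
    have "{d \<in> darts G. tail G d \<in> S} = (\<Union>v\<in>S. {d \<in> darts G. tail G d = v})"
      by auto
    then show ?thesis
      using that fin by (simp add: degree_def card_UN_disjoint disjoint_iff)
  qed
  let ?T = "{d \<in> darts G. tail G d \<in> ?W}"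
  have TF: "?T \<subseteq> ?F"
    using Dt by auto
  have deg: "degree G v \<ge> 2" if "v \<in> ?W" for v
    using that \<open>pruned G\<close> by (auto simp: pruned_def)
  have "2 * card ?W \<le> (\<Sum>v\<in>?W. degree G v)"
    using sum_bounded_below[of ?W 2 "degree G"] deg by (simp add: mult.commute)
  then have le1: "2 * card ?W \<le> card ?T"
    using card_tail[of ?W] fin by simp
  have le2: "card ?T \<le> card ?F"
    using TF fin by (simp add: card_mono)
  show ?thesis
  proof (rule ccontr)
    assume "\<not> 2 * card ?W < card ?F"
    then have eq: "2 * card ?W = card ?T" "card ?T = card ?F"
      using le1 le2 by auto
    then have TF_eq: "?T = ?F"
      using TF fin by (simp add: card_subset_eq)
    have deg2: "degree G v = 2" if "v \<in> ?W" for v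
    proof (rule ccontr)
      assume "degree G v \<noteq> 2"
      then have "(\<Sum>v\<in>?W. 2) < (\<Sum>v\<in>?W. degree G v)"
        using that deg fin by (intro sum_strict_mono_ex1) (auto intro!: bexI[of _ v] simp: le_neq_implies_less)
      then show False
        using eq(1) card_tail[of ?W] fin by simp
    qed
    show False
    \<comment> \<open>If no vertex is missing, \<open>TF_eq\<close> says that no dart is missing
      either, contradicting properness.\<close>
    proof (cases "?W = {}")
      case True
      then show ?thesis
        using TF_eq Q D ne by auto
    next
      case False
      then obtain w where w: "w \<in> ?W"
        by blast
      \<comment> \<open>The missing darts are closed under reversal since \<open>D\<close> is, and
        by \<open>TF_eq\<close> every missing dart has its tail in \<open>?W\<close>.\<close>
      have closed: "head G d \<in> ?W" if "d \<in> darts G" "tail G d \<in> ?W" for d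
      proof -
        have "d \<in> ?F"
          using that TF by auto
        then have "rv G d \<in> ?F"
          using G Dr by fastforce
        then show ?thesis
          using TF_eq unfolding head_def by auto
      qed
      have reach: "u \<in> ?W" if "(w, u) \<in> (adj G)\<^sup>*" for u
        using that
      proof (induction rule: rtrancl_induct)
        case (step y z)
        then show ?case
          using closed by (auto simp: adj_def)
      qed (rule w)
      let ?C = "{u \<in> verts G. (w, u) \<in> (adj G)\<^sup>*}"
      have "?C \<in> components G"
        using w by (auto simp: components_def)
      then have "comp_ord G ?C \<ge> 1"
        by (rule comp)
      \<comment> \<open>The component of \<open>w\<close> lies in \<open>?W\<close>, where all
        degrees are two, so it has as many edges as vertices and order zero.\<close>
      moreover have "card {d \<in> darts G. tail G d \<in> ?C} = 2 * card ?C"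
        using card_tail[of ?C] fin deg2 reach by simp
      ultimately show False
        unfolding comp_ord_def by simp
    qed
  qed
qed

section \<open>Occurrences as labellings\<close>

lemma morphism_tailD: "is_morphism G H fv fd \<Longrightarrow> d \<in> darts G \<Longrightarrow> tail H (fd d) = fv (tail G d)"
  and morphism_rvD: "is_morphism G H fv fd \<Longrightarrow> d \<in> darts G \<Longrightarrow> rv H (fd d) = fd (rv G d)"
  by (simp_all add: is_morphism_def)

locale etale_morphism =
  fixes B :: "('v, 'd) graph" and \<psi> :: "('w, 'e) graph"
    and \<phi>V :: "'w \<Rightarrow> 'v" and \<phi>D :: "'e \<Rightarrow> 'd"
  assumes wf_B: "wf_graph B" and wf_\<psi>: "wf_graph \<psi>" and etale: "etale \<psi> B \<phi>V \<phi>D"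
begin

abbreviation "lift a \<equiv> \<lambda>v. (\<phi>V v, a v)"

text \<open>The first coordinate of an occurrence on vertices is forced to be
  \<open>\<phi>V\<close>, so only the second is kept. Extensionality makes the encoding
  unique.\<close>

definition labellings :: "nat \<Rightarrow> ('w \<Rightarrow> nat) set" where
  "labellings n = {a \<in> verts \<psi> \<rightarrow>\<^sub>E {..<n}. inj_on (lift a) (verts \<psi>)}"

definition constraint :: "('w \<Rightarrow> nat) \<Rightarrow> 'e \<Rightarrow> 'd \<times> nat \<times> nat" where
  "constraint a d = (\<phi>D d, a (tail \<psi> d), a (head \<psi> d))"

abbreviation constraints :: "('w \<Rightarrow> nat) \<Rightarrow> ('d \<times> nat \<times> nat) set" where
  "constraints a \<equiv> constraint a ` darts \<psi>"

definition occs :: "nat \<Rightarrow> ('d \<Rightarrow> nat \<Rightarrow> nat) \<Rightarrow> ('w \<Rightarrow> nat) set" where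
  "occs n \<sigma> = {a \<in> labellings n. \<forall>d\<in>darts \<psi>. \<sigma> (\<phi>D d) (a (tail \<psi> d)) = a (head \<psi> d)}"

lemma finite_verts: "finite (verts \<psi>)" and finite_darts: "finite (darts \<psi>)"
  using wf_\<psi> by (auto simp: wf_graph_def)

lemma dart_props:
  assumes "d \<in> darts \<psi>"
  shows "tail \<psi> d \<in> verts \<psi>" "head \<psi> d \<in> verts \<psi>" "rv \<psi> d \<in> darts \<psi>" "rv \<psi> (rv \<psi> d) = d"
    "head \<psi> (rv \<psi> d) = tail \<psi> d" "tail \<psi> (rv \<psi> d) = head \<psi> d"
    "\<phi>D d \<in> darts B" "tail B (\<phi>D d) = \<phi>V (tail \<psi> d)" "rv B (\<phi>D d) = \<phi>D (rv \<psi> d)"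
  using assms wf_\<psi> etale by (auto simp: wf_graph_def etale_def is_morphism_def head_def)

lemma \<phi>V_verts: "v \<in> verts \<psi> \<Longrightarrow> \<phi>V v \<in> verts B"
  using etale by (simp add: etale_def is_morphism_def)

lemma etale_unique:
  assumes "d \<in> darts \<psi>" "d' \<in> darts \<psi>" "\<phi>D d = \<phi>D d'" "tail \<psi> d = tail \<psi> d'"
  shows "d = d'"
  using assms etale dart_props(1)[OF assms(1)] by (auto simp: etale_def inj_on_def)

text \<open>Tails of darts with a common image in \<open>B\<close> lie in one fibre of
  \<open>\<phi>V\<close>, where \<open>a\<close> is injective; etaleness then identifies the darts.
  Hence injectivity on vertices gives injectivity on darts.\<close>

lemma labelling_cong:
  assumes "a \<in> labellings n" "d \<in> darts \<psi>" "d' \<in> darts \<psi>" "\<phi>D d = \<phi>D d'"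
    "a (tail \<psi> d) = a (tail \<psi> d')"
  shows "d = d'"
proof -
  have "lift a (tail \<psi> d) = lift a (tail \<psi> d')"
    using assms dart_props(8)[of d] dart_props(8)[of d'] by simp
  then have "tail \<psi> d = tail \<psi> d'"
    using assms(1) dart_props(1) assms(2,3) by (auto simp: labellings_def dest: inj_onD)
  then show ?thesis
    using assms etale_unique by blast
qed

lemma inj_on_constraint:
  assumes "a \<in> labellings n"
  shows "inj_on (constraint a) (darts \<psi>)"
  using labelling_cong[OF assms] by (auto simp: inj_on_def constraint_def)

lemma constraints_functional:
  assumes "a \<in> labellings n" "(e, i, j) \<in> constraints a" "(e, i, j') \<in> constraints a"
  shows "j = j'"
  using assms labelling_cong[OF assms(1)] by (auto simp: constraint_def)

lemma constraint_rv:
  assumes "d \<in> darts \<psi>"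
  shows "constraint a (rv \<psi> d) = (\<lambda>(e, i, j). (rv B e, j, i)) (constraint a d)"
  using dart_props[OF assms] by (simp add: constraint_def)

lemma constraints_swap:
  assumes "(e, i, j) \<in> constraints a"
  shows "(rv B e, j, i) \<in> constraints a"
proof -
  obtain d where d: "d \<in> darts \<psi>" "constraint a d = (e, i, j)"
    using assms by force
  then have "constraint a (rv \<psi> d) = (rv B e, j, i)"
    by (simp add: constraint_rv)
  then show ?thesis
    using dart_props(3)[OF d(1)] by (metis imageI)
qed

lemma constraints_subset:
  assumes "a \<in> labellings n"
  shows "constraints a \<subseteq> darts B \<times> {..<n} \<times> {..<n}"
  using assms dart_props by (fastforce simp: constraint_def labellings_def)

lemma occs_iff_satisfying:
  assumes "\<sigma> \<in> cover_perms B n"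
  shows "a \<in> occs n \<sigma> \<longleftrightarrow> a \<in> labellings n \<and> \<sigma> \<in> satisfying B n (constraints a)"
  using assms by (auto simp: occs_def satisfying_def constraint_def)

lemma finite_labellings: "finite (labellings n)"
proof -
  have "finite (verts \<psi> \<rightarrow>\<^sub>E {..<n})"
    using finite_verts by (simp add: finite_PiE)
  then show ?thesis
    by (rule finite_subset[rotated]) (auto simp: labellings_def)
qed

lemma finite_occs: "finite (occs n \<sigma>)"
  using finite_labellings by (rule finite_subset[rotated]) (auto simp: occs_def)

text \<open>A dart of the cover carries the index of its tail, so the dart map of an occurrence is
  recovered from its vertex map. What remains of the morphism property is the compatibility with
  reversal, which is the condition on \<open>\<sigma>\<close> in \<open>occs\<close>.\<close>

lemma num_occurs_eq_card_occs:
  assumes "\<sigma> \<in> cover_perms B n"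
  shows "num_occurs \<psi> \<phi>V \<phi>D (cover_graph B n \<sigma>) = card (occs n \<sigma>)"
proof -
  let ?G = "cover_graph B n \<sigma>"
  let ?S = "{(fv, fd).
      fv \<in> verts \<psi> \<rightarrow>\<^sub>E verts ?G \<and> fd \<in> darts \<psi> \<rightarrow>\<^sub>E darts ?G \<and>
      is_morphism \<psi> ?G fv fd \<and> inj_on fv (verts \<psi>) \<and> inj_on fd (darts \<psi>) \<and>
      (\<forall>v \<in> verts \<psi>. fst (fv v) = \<phi>V v) \<and> (\<forall>d \<in> darts \<psi>. fst (fd d) = \<phi>D d)}"
  let ?f = "\<lambda>a. (restrict (lift a) (verts \<psi>), restrict (\<lambda>d. (\<phi>D d, a (tail \<psi> d))) (darts \<psi>))"
  let ?g = "\<lambda>(fv, fd). restrict (\<lambda>v. snd (fv v)) (verts \<psi>)"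
  have G: "verts ?G = verts B \<times> {..<n}" "darts ?G = darts B \<times> {..<n}"
    "tail ?G (e, i) = (tail B e, i)" "rv ?G (e, i) = (rv B e, \<sigma> e i)" for e i
    by (auto simp: cover_graph_def)
  have "bij_betw ?f (occs n \<sigma>) ?S"
  proof (rule bij_betw_byWitness[where f' = ?g])
    show "\<forall>a\<in>occs n \<sigma>. ?g (?f a) = a"
      by (auto simp: occs_def labellings_def fun_eq_iff PiE_def extensional_def)
    show "\<forall>p\<in>?S. ?f (?g p) = p"
    proof
      fix p assume p: "p \<in> ?S"
      obtain fv fd where p_eq: "p = (fv, fd)"
        by (cases p)
      have fv: "fv \<in> verts \<psi> \<rightarrow>\<^sub>E verts ?G" and fd: "fd \<in> darts \<psi> \<rightarrow>\<^sub>E darts ?G"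
        and m: "is_morphism \<psi> ?G fv fd" and V: "\<forall>v \<in> verts \<psi>. fst (fv v) = \<phi>V v"
        and D: "\<forall>d \<in> darts \<psi>. fst (fd d) = \<phi>D d"
        using p unfolding p_eq by blast+
      have "restrict (lift (?g (fv, fd))) (verts \<psi>) = fv"
        using fv V by (auto simp: fun_eq_iff PiE_def extensional_def intro: prod_eqI)
      moreover have "fd d = (\<phi>D d, snd (fv (tail \<psi> d)))" if d: "d \<in> darts \<psi>" for d
      proof -
        obtain i where i: "fd d = (\<phi>D d, i)"
          using bspec[OF D d] by (cases "fd d") auto
        then have "fv (tail \<psi> d) = (tail B (\<phi>D d), i)"
          using morphism_tailD[OF m d] G(3)[of "\<phi>D d" i] by simp
        then show ?thesis
          using i by simp
      qed
      then have "restrict (\<lambda>d. (\<phi>D d, ?g (fv, fd) (tail \<psi> d))) (darts \<psi>) = fd"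
        using fd dart_props(1) by (auto simp: fun_eq_iff PiE_def extensional_def)
      ultimately show "?f (?g p) = p"
        unfolding p_eq by blast
    qed
    show "?f ` occs n \<sigma> \<subseteq> ?S"
    proof clarify
      fix a assume a: "a \<in> occs n \<sigma>"
      then have L: "a \<in> labellings n" and S: "\<And>d. d \<in> darts \<psi> \<Longrightarrow> \<sigma> (\<phi>D d) (a (tail \<psi> d)) = a (head \<psi> d)"
        by (auto simp: occs_def)
      have lt: "\<And>v. v \<in> verts \<psi> \<Longrightarrow> a v < n" and inj: "inj_on (lift a) (verts \<psi>)"
        using L by (auto simp: labellings_def)
      have "is_morphism \<psi> ?G (restrict (lift a) (verts \<psi>)) (restrict (\<lambda>d. (\<phi>D d, a (tail \<psi> d))) (darts \<psi>))"
        using lt S \<phi>V_verts dart_props by (auto simp: is_morphism_def G)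
      moreover have "inj_on (\<lambda>d. (\<phi>D d, a (tail \<psi> d))) (darts \<psi>)"
        using labelling_cong[OF L] by (auto simp: inj_on_def)
      ultimately show "restrict (lift a) (verts \<psi>) \<in> verts \<psi> \<rightarrow>\<^sub>E verts ?G \<and>
          restrict (\<lambda>d. (\<phi>D d, a (tail \<psi> d))) (darts \<psi>) \<in> darts \<psi> \<rightarrow>\<^sub>E darts ?G \<and>
          is_morphism \<psi> ?G (restrict (lift a) (verts \<psi>)) (restrict (\<lambda>d. (\<phi>D d, a (tail \<psi> d))) (darts \<psi>)) \<and>
          inj_on (restrict (lift a) (verts \<psi>)) (verts \<psi>) \<and>
          inj_on (restrict (\<lambda>d. (\<phi>D d, a (tail \<psi> d))) (darts \<psi>)) (darts \<psi>) \<and>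
          (\<forall>v\<in>verts \<psi>. fst (restrict (lift a) (verts \<psi>) v) = \<phi>V v) \<and>
          (\<forall>d\<in>darts \<psi>. fst (restrict (\<lambda>d. (\<phi>D d, a (tail \<psi> d))) (darts \<psi>) d) = \<phi>D d)"
        using lt inj \<phi>V_verts dart_props by (auto simp: G inj_on_restrict_eq)
    qed
    show "?g ` ?S \<subseteq> occs n \<sigma>"
    proof clarify
      fix fv fd
      assume fv: "fv \<in> verts \<psi> \<rightarrow>\<^sub>E verts ?G" 
        and m: "is_morphism \<psi> ?G fv fd" and inj: "inj_on fv (verts \<psi>)"
        and V: "\<forall>v \<in> verts \<psi>. fst (fv v) = \<phi>V v"
        and D: "\<forall>d \<in> darts \<psi>. fst (fd d) = \<phi>D d"
      let ?a = "restrict (\<lambda>v. snd (fv v)) (verts \<psi>)"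
      have eq: "lift ?a v = fv v" if "v \<in> verts \<psi>" for v
        using V that by (auto intro: prod_eqI)
      have "inj_on (lift ?a) (verts \<psi>)"
        using inj inj_on_cong[of "verts \<psi>" "lift ?a" fv] eq by blast
      moreover have "?a \<in> verts \<psi> \<rightarrow>\<^sub>E {..<n}"
      proof -
        have "fv v \<in> verts B \<times> {..<n}" if "v \<in> verts \<psi>" for v
          using fv that by (auto simp: G)
        then show ?thesis
          by (auto simp: mem_Times_iff)
      qed
      moreover have "\<sigma> (\<phi>D d) (?a (tail \<psi> d)) = ?a (head \<psi> d)" if d: "d \<in> darts \<psi>" for d
      proof -
        obtain i where i: "fd d = (\<phi>D d, i)"
          using bspec[OF D d] by (cases "fd d") auto
        obtain j where j: "fd (rv \<psi> d) = (\<phi>D (rv \<psi> d), j)"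
          using bspec[OF D dart_props(3)[OF d]] by (cases "fd (rv \<psi> d)") auto
        have "fv (tail \<psi> d) = (tail B (\<phi>D d), i)"
          using morphism_tailD[OF m d] i G(3)[of "\<phi>D d" i] by simp
        moreover have "fv (head \<psi> d) = (tail B (\<phi>D (rv \<psi> d)), j)"
          using morphism_tailD[OF m dart_props(3)[OF d]] j G(3)[of "\<phi>D (rv \<psi> d)" j]
          by (simp add: head_def)
        \<comment> \<open>Reversal in the cover changes the index \<open>i\<close> to the image of
          \<open>i\<close> under the permutation, so this image is the label of the head.\<close>
        moreover have "(\<phi>D (rv \<psi> d), j) = (rv B (\<phi>D d), \<sigma> (\<phi>D d) i)"
          using morphism_rvD[OF m d] i j G(4)[of "\<phi>D d" i] by simp
        ultimately show ?thesis
          using dart_props[OF d] by simp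
      qed
      ultimately show "?a \<in> occs n \<sigma>"
        by (simp add: occs_def labellings_def)
    qed
  qed
  then show ?thesis
    unfolding num_occurs_def by (simp add: bij_betw_same_card)
qed

section \<open>Counting labellings and double counting\<close>

lemma card_labellings_le: "card (labellings n) \<le> n ^ card (verts \<psi>)"
proof -
  have "card (labellings n) \<le> card (verts \<psi> \<rightarrow>\<^sub>E {..<n})"
    using finite_verts by (intro card_mono) (auto simp: labellings_def finite_PiE)
  then show ?thesis
    using finite_verts by (simp add: card_PiE)
qed

text \<open>Only the labellings that are injective on all of \<open>verts \<psi>\<close> are
  counted; their number, a falling factorial, already has the right leading term.\<close>

lemma card_labellings_ge:
  "(n - card (verts \<psi>)) ^ card (verts \<psi>) \<le> card (labellings n)"
proof -
  let ?k = "card (verts \<psi>)"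
  have "(n - ?k) ^ ?k = (\<Prod>i = 0..<?k. n - ?k)"
    by simp
  also have "\<dots> \<le> (\<Prod>i = 0..<?k. n - i)"
    by (intro prod_mono) auto
  also have "\<dots> = card {a \<in> verts \<psi> \<rightarrow>\<^sub>E {..<n}. inj_on a (verts \<psi>)}"
    using finite_verts by (subst card_inj_on_subset_funcset) auto
  also have "\<dots> \<le> card (labellings n)"
    using finite_labellings by (intro card_mono) (auto simp: labellings_def inj_on_def)
  finally show ?thesis .
qed

text \<open>Linearity of expectation as an exchange of sums. It is stated for general
  \<open>S\<close> and \<open>T\<close> to serve both single occurrences and pairs.\<close>

lemma sum_card_eq_sum_satisfying:
  assumes "\<And>\<sigma>. \<sigma> \<in> cover_perms B n \<Longrightarrow> finite (S \<sigma>)" "finite T"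
    "\<And>\<sigma> x. \<sigma> \<in> cover_perms B n \<Longrightarrow> x \<in> S \<sigma> \<longleftrightarrow> x \<in> T \<and> \<sigma> \<in> satisfying B n (C x)"
  shows "(\<Sum>\<sigma>\<in>cover_perms B n. card (S \<sigma>)) = (\<Sum>x\<in>T. card (satisfying B n (C x)))"
proof -
  have fin: "finite (cover_perms B n)"
    using card_cover_perms_pos[OF wf_B] by blast
  have sat: "satisfying B n (C x) = {\<sigma> \<in> cover_perms B n. \<sigma> \<in> satisfying B n (C x)}" for x
    by (auto simp: satisfying_def)
  have "(\<Sum>\<sigma>\<in>cover_perms B n. card (S \<sigma>)) =
      (\<Sum>\<sigma>\<in>cover_perms B n. \<Sum>x\<in>T. if \<sigma> \<in> satisfying B n (C x) then 1 else 0)"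
  proof (rule sum.cong)
    fix \<sigma> assume "\<sigma> \<in> cover_perms B n"
    then have "S \<sigma> = {x \<in> T. \<sigma> \<in> satisfying B n (C x)}"
      using assms(3) by blast
    then show "card (S \<sigma>) = (\<Sum>x\<in>T. if \<sigma> \<in> satisfying B n (C x) then 1 else 0)"
      using assms(2) by (simp add: sum.If_cases Int_def)
  qed simp
  also have "\<dots> = (\<Sum>x\<in>T. \<Sum>\<sigma>\<in>cover_perms B n. if \<sigma> \<in> satisfying B n (C x) then 1 else 0)"
    by (rule sum.swap)
  also have "\<dots> = (\<Sum>x\<in>T. card (satisfying B n (C x)))"
    using fin by (subst (2) sat) (simp add: sum.If_cases Int_def)
  finally show ?thesis .
qed

section \<open>The expected number of occurrences\<close>

definition num_edges :: nat where
  "num_edges = card (darts \<psi>) div 2"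

lemma card_darts: "card (darts \<psi>) = 2 * num_edges"
  using wf_graph_even_darts[OF wf_\<psi>] by (simp add: num_edges_def)

text \<open>Every labelling prescribes exactly \<open>num_edges\<close> undirected edges of the
  cover, so the bounds on its probability do not depend on the labelling and only the number of
  labellings enters.\<close>

lemma expected_occurs_bounds:
  assumes "n > num_edges" "n \<ge> card (verts \<psi>)"
  shows "expected_occurs B \<psi> \<phi>V \<phi>D n \<le> real n ^ card (verts \<psi>) / (real n - num_edges) ^ num_edges"
    and "expected_occurs B \<psi> \<phi>V \<phi>D n \<ge> (real n - card (verts \<psi>)) ^ card (verts \<psi>) / real n ^ num_edges"
proof -
  let ?N = "card (cover_perms B n)" and ?m = "num_edges" and ?k = "card (verts \<psi>)"
  have N: "real ?N > 0"
    using card_cover_perms_pos[OF wf_B] by simp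
  have n: "n > 0"
    using assms(1) by simp
  have E: "expected_occurs B \<psi> \<phi>V \<phi>D n = (\<Sum>a\<in>labellings n. card (satisfying B n (constraints a)) / ?N)"
  proof -
    have "(\<Sum>\<sigma>\<in>cover_perms B n. num_occurs \<psi> \<phi>V \<phi>D (cover_graph B n \<sigma>)) =
        (\<Sum>\<sigma>\<in>cover_perms B n. card (occs n \<sigma>))"
      by (intro sum.cong) (auto simp: num_occurs_eq_card_occs)
    also have "\<dots> = (\<Sum>a\<in>labellings n. card (satisfying B n (constraints a)))"
      by (rule sum_card_eq_sum_satisfying) (auto simp: finite_occs finite_labellings occs_iff_satisfying)
    finally show ?thesis
      unfolding expected_occurs_def
      by (simp add: sum_divide_distrib[symmetric] flip: of_nat_sum)
  qed
  have card_c: "card (constraints a) = 2 * ?m" if "a \<in> labellings n" for a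
    using card_image[OF inj_on_constraint[OF that]] card_darts by simp
  have up: "card (satisfying B n (constraints a)) / ?N \<le> 1 / (real n - ?m) ^ ?m"
    and low: "card (satisfying B n (constraints a)) / ?N \<ge> 1 / real n ^ ?m" if a: "a \<in> labellings n" for a
  proof -
    note * = card_satisfying_bounds[OF wf_B constraints_subset[OF a] _ card_c[OF a], OF constraints_swap]
    have "real ((n - ?m) ^ ?m * card (satisfying B n (constraints a))) \<le> ?N"
      using *(1) by (simp only: of_nat_le_iff)
    then have "(real n - ?m) ^ ?m * card (satisfying B n (constraints a)) \<le> ?N"
      using assms(1) by (simp add: of_nat_diff)
    then show "card (satisfying B n (constraints a)) / ?N \<le> 1 / (real n - ?m) ^ ?m"
      using N assms(1) by (simp add: field_simps)
    have "real ?N \<le> real (n ^ ?m * card (satisfying B n (constraints a)))"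
      using *(2) constraints_functional[OF a] by (simp only: of_nat_le_iff)
    then show "card (satisfying B n (constraints a)) / ?N \<ge> 1 / real n ^ ?m"
      using N n by (simp add: field_simps)
  qed
  have "expected_occurs B \<psi> \<phi>V \<phi>D n \<le> card (labellings n) * (1 / (real n - ?m) ^ ?m)"
    unfolding E by (rule sum_bounded_above) (rule up)
  also have "\<dots> \<le> real n ^ ?k * (1 / (real n - ?m) ^ ?m)"
    using card_labellings_le[of n] assms(1) by (intro mult_right_mono) (simp_all flip: of_nat_power)
  finally show "expected_occurs B \<psi> \<phi>V \<phi>D n \<le> real n ^ ?k / (real n - ?m) ^ ?m"
    by simp
  have "real ((n - ?k) ^ ?k) \<le> card (labellings n)"
    using card_labellings_ge[of n] by (simp only: of_nat_le_iff)
  then have "(real n - ?k) ^ ?k \<le> card (labellings n)"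
    using assms(2) by (simp add: of_nat_diff)
  then have "(real n - ?k) ^ ?k * (1 / real n ^ ?m) \<le> card (labellings n) * (1 / real n ^ ?m)"
    by (intro mult_right_mono) simp_all
  also have "\<dots> \<le> expected_occurs B \<psi> \<phi>V \<phi>D n"
    unfolding E by (rule sum_bounded_below) (rule low)
  finally show "expected_occurs B \<psi> \<phi>V \<phi>D n \<ge> (real n - ?k) ^ ?k / real n ^ ?m"
    by simp
qed

section \<open>Overlapping pairs of occurrences\<close>

text \<open>Inclusion of images is the same as equality, since all images have the size of \<open>\<psi>\<close>.\<close>

definition same_image :: "('w \<Rightarrow> nat) \<Rightarrow> ('w \<Rightarrow> nat) \<Rightarrow> bool" where
  "same_image a a' \<longleftrightarrow> lift a' ` verts \<psi> \<subseteq> lift a ` verts \<psi> \<and> constraints a' \<subseteq> constraints a"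

text \<open>The intersection of the two vertex images, pulled back to \<open>\<psi>\<close> along
  the second occurrence so that it spans a subgraph of \<open>\<psi>\<close> itself.\<close>

definition overlap :: "('w \<Rightarrow> nat) \<Rightarrow> ('w \<Rightarrow> nat) \<Rightarrow> 'w set" where
  "overlap a a' = {v \<in> verts \<psi>. lift a' v \<in> lift a ` verts \<psi>}"

section \<open>Occurrences with a common image and automorphisms\<close>

lemma occs_comp_aut:
  assumes a: "a \<in> occs n \<sigma>" and f: "(fv, fd) \<in> aut \<psi> \<phi>V \<phi>D"
  shows "restrict (\<lambda>v. a (fv v)) (verts \<psi>) \<in> occs n \<sigma>"
    and "same_image a (restrict (\<lambda>v. a (fv v)) (verts \<psi>))"
proof -
  let ?a = "restrict (\<lambda>v. a (fv v)) (verts \<psi>)"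
  have L: "a \<in> verts \<psi> \<rightarrow>\<^sub>E {..<n}" "inj_on (lift a) (verts \<psi>)"
    and S: "\<And>d. d \<in> darts \<psi> \<Longrightarrow> \<sigma> (\<phi>D d) (a (tail \<psi> d)) = a (head \<psi> d)"
    using a by (auto simp: occs_def labellings_def)
  have m: "is_morphism \<psi> \<psi> fv fd" and bV: "bij_betw fv (verts \<psi>) (verts \<psi>)"
    and V: "\<And>v. v \<in> verts \<psi> \<Longrightarrow> \<phi>V (fv v) = \<phi>V v"
    and D: "\<And>d. d \<in> darts \<psi> \<Longrightarrow> \<phi>D (fd d) = \<phi>D d"
    using f by (auto simp: aut_def)
  have fv: "fv v \<in> verts \<psi>" if "v \<in> verts \<psi>" for v
    using that m by (simp add: is_morphism_def)
  have fd: "fd d \<in> darts \<psi>" if "d \<in> darts \<psi>" for d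
    using that m by (simp add: is_morphism_def)
  have t: "tail \<psi> (fd d) = fv (tail \<psi> d)" "head \<psi> (fd d) = fv (head \<psi> d)" if "d \<in> darts \<psi>" for d
    using morphism_tailD[OF m that] morphism_rvD[OF m that] morphism_tailD[OF m dart_props(3)[OF that]]
    by (simp_all add: head_def)
  have lift: "lift ?a v = lift a (fv v)" if "v \<in> verts \<psi>" for v
    using that V by simp
  have c: "constraint ?a d = constraint a (fd d)" if "d \<in> darts \<psi>" for d
    using that D t dart_props(1,2) by (simp add: constraint_def)
  have "inj_on (lift a \<circ> fv) (verts \<psi>)"
    using bV L(2) by (intro comp_inj_on) (auto simp: bij_betw_def)
  then have "inj_on (lift ?a) (verts \<psi>)"
    using lift by (subst inj_on_cong[of _ _ "lift a \<circ> fv"]) auto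
  moreover have "?a \<in> verts \<psi> \<rightarrow>\<^sub>E {..<n}"
    using L fv by auto
  moreover have "\<sigma> (\<phi>D d) (?a (tail \<psi> d)) = ?a (head \<psi> d)" if "d \<in> darts \<psi>" for d
    using S[OF fd[OF that]] D[OF that] t[OF that] dart_props(1,2)[OF that] by simp
  ultimately show "?a \<in> occs n \<sigma>"
    by (simp add: occs_def labellings_def)
  show "same_image a ?a"
    unfolding same_image_def
  proof (intro conjI image_subsetI)
    show "lift ?a v \<in> lift a ` verts \<psi>" if "v \<in> verts \<psi>" for v
      unfolding lift[OF that] using fv[OF that] by (rule imageI)
    show "constraint ?a d \<in> constraints a" if "d \<in> darts \<psi>" for d
      unfolding c[OF that] using fd[OF that] by (rule imageI)
  qed
qed

text \<open>The automorphism is the second occurrence followed by the inverse of the first, on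
  vertices and on darts. Inclusion of images suffices, since an injective self-map of a finite set
  is bijective.\<close>

lemma same_image_imp_aut:
  assumes a: "a \<in> labellings n" and a': "a' \<in> labellings n" and "same_image a a'"
  obtains fv fd where "(fv, fd) \<in> aut \<psi> \<phi>V \<phi>D" "a' = restrict (\<lambda>v. a (fv v)) (verts \<psi>)"
proof -
  let ?V = "verts \<psi>" and ?D = "darts \<psi>"
  define fv where "fv = restrict (\<lambda>v. inv_into ?V (lift a) (lift a' v)) ?V"
  define fd where "fd = restrict (\<lambda>d. inv_into ?D (constraint a) (constraint a' d)) ?D"
  have inj: "inj_on (lift a) ?V" and inj': "inj_on (lift a') ?V"
    using a a' by (auto simp: labellings_def)
  have V: "fv v \<in> ?V" "lift a (fv v) = lift a' v" if "v \<in> ?V" for v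
  proof -
    have *: "lift a' v \<in> lift a ` ?V"
      using assms(3) that by (auto simp: same_image_def)
    show "fv v \<in> ?V"
      using inv_into_into[OF *] that by (simp add: fv_def)
    show "lift a (fv v) = lift a' v"
      using f_inv_into_f[OF *] that by (simp add: fv_def)
  qed
  have D: "fd d \<in> ?D" "constraint a (fd d) = constraint a' d" if "d \<in> ?D" for d
  proof -
    have *: "constraint a' d \<in> constraint a ` ?D"
      using assms(3) that by (auto simp: same_image_def)
    show "fd d \<in> ?D"
      using inv_into_into[OF *] that by (simp add: fd_def)
    show "constraint a (fd d) = constraint a' d"
      using f_inv_into_f[OF *] that by (simp add: fd_def)
  qed
  have "inj_on fv ?V"
    using V inj' by (metis (no_types, lifting) inj_onD inj_onI)
  then have bV: "bij_betw fv ?V ?V"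
    using V(1) finite_verts by (simp add: bij_betw_def endo_inj_surj image_subsetI)
  have "inj_on fd ?D"
    using D inj_on_constraint[OF a'] by (metis inj_onD inj_onI)
  then have bD: "bij_betw fd ?D ?D"
    using D(1) finite_darts by (simp add: bij_betw_def endo_inj_surj image_subsetI)
  have \<phi>D: "\<phi>D (fd d) = \<phi>D d" "a (tail \<psi> (fd d)) = a' (tail \<psi> d)" if "d \<in> ?D" for d
    using D(2)[OF that] by (auto simp: constraint_def)
  have tl: "tail \<psi> (fd d) = fv (tail \<psi> d)" if d: "d \<in> ?D" for d
  proof -
    have "\<phi>V (tail \<psi> (fd d)) = \<phi>V (tail \<psi> d)"
      using dart_props(8)[OF D(1)[OF d]] dart_props(8)[OF d] \<phi>D(1)[OF d] by simp
    then have "lift a (tail \<psi> (fd d)) = lift a (fv (tail \<psi> d))"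
      using V(2)[OF dart_props(1)[OF d]] \<phi>D(2)[OF d] by simp
    then show ?thesis
      using inj_onD[OF inj] dart_props(1)[OF D(1)[OF d]] V(1)[OF dart_props(1)[OF d]] by blast
  qed
  \<comment> \<open>Both darts have the same constraint under \<open>a\<close>, namely the reversal
    of \<open>constraint a' d\<close>, and \<open>constraint a\<close> is injective on
    darts.\<close>
  have rv: "rv \<psi> (fd d) = fd (rv \<psi> d)" if d: "d \<in> ?D" for d
  proof -
    have "constraint a (rv \<psi> (fd d)) = constraint a (fd (rv \<psi> d))"
      using constraint_rv[OF D(1)[OF d]] constraint_rv[OF d] D(2)[OF d] D(2)[OF dart_props(3)[OF d]]
      by simp
    then show ?thesis
      using inj_onD[OF inj_on_constraint[OF a]] dart_props(3)[OF D(1)[OF d]] D(1)[OF dart_props(3)[OF d]]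
      by blast
  qed
  have "is_morphism \<psi> \<psi> fv fd"
    using V(1) D(1) tl rv by (simp add: is_morphism_def)
  moreover have "fv \<in> ?V \<rightarrow>\<^sub>E ?V" "fd \<in> ?D \<rightarrow>\<^sub>E ?D"
    using V(1) D(1) by (auto simp: fv_def fd_def)
  moreover have "\<forall>v\<in>?V. \<phi>V (fv v) = \<phi>V v"
    using V(2) by simp
  ultimately have "(fv, fd) \<in> aut \<psi> \<phi>V \<phi>D"
    using bV bD \<phi>D(1) by (simp add: aut_def)
  moreover have "a' = restrict (\<lambda>v. a (fv v)) ?V"
  proof
    fix v
    show "a' v = restrict (\<lambda>v. a (fv v)) ?V v"
      using V(2)[of v] a' by (auto simp: labellings_def PiE_def extensional_def)
  qed
  ultimately show ?thesis
    using that by blast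
qed

text \<open>\<open>Aut\<close> acts freely and transitively on these occurrences. Freeness on
  vertices is the injectivity of \<open>lift a\<close>, and on darts it follows by
  etaleness.\<close>

lemma card_same_image:
  assumes a: "a \<in> occs n \<sigma>"
  shows "card {a' \<in> occs n \<sigma>. same_image a a'} = card (aut \<psi> \<phi>V \<phi>D)"
proof -
  let ?h = "\<lambda>(fv, fd :: 'e \<Rightarrow> 'e). restrict (\<lambda>v. a (fv v)) (verts \<psi>)"
  have L: "a \<in> labellings n"
    using a by (simp add: occs_def)
  have inj: "inj_on (lift a) (verts \<psi>)"
    using L by (simp add: labellings_def)
  have "inj_on ?h (aut \<psi> \<phi>V \<phi>D)"
  proof (rule inj_onI, clarify)
    fix fv fd gv gd
    assume f: "(fv, fd) \<in> aut \<psi> \<phi>V \<phi>D" and g: "(gv, gd) \<in> aut \<psi> \<phi>V \<phi>D"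
      and eq: "restrict (\<lambda>v. a (fv v)) (verts \<psi>) = restrict (\<lambda>v. a (gv v)) (verts \<psi>)"
    have m: "is_morphism \<psi> \<psi> fv fd" "is_morphism \<psi> \<psi> gv gd"
      using f g by (auto simp: aut_def)
    have V: "fv v = gv v" if v: "v \<in> verts \<psi>" for v
    proof -
      have "a (fv v) = a (gv v)"
        using fun_cong[OF eq, of v] v by simp
      moreover have "\<phi>V (fv v) = \<phi>V (gv v)"
        using f g v by (simp add: aut_def)
      moreover have "fv v \<in> verts \<psi>" "gv v \<in> verts \<psi>"
        using m v by (auto simp: is_morphism_def)
      ultimately show ?thesis
        using inj_onD[OF inj, of "fv v" "gv v"] by simp
    qed
    have D: "fd d = gd d" if d: "d \<in> darts \<psi>" for d
    proof (rule etale_unique)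
      show "fd d \<in> darts \<psi>" "gd d \<in> darts \<psi>"
        using m d by (auto simp: is_morphism_def)
      show "\<phi>D (fd d) = \<phi>D (gd d)"
        using f g d by (simp add: aut_def)
      show "tail \<psi> (fd d) = tail \<psi> (gd d)"
        using morphism_tailD[OF m(1) d] morphism_tailD[OF m(2) d] V dart_props(1)[OF d] by simp
    qed
    have "fv = gv"
      by (rule PiE_ext[of _ "verts \<psi>" "\<lambda>_. verts \<psi>"]) (use f g V in \<open>auto simp: aut_def\<close>)
    moreover have "fd = gd"
      by (rule PiE_ext[of _ "darts \<psi>" "\<lambda>_. darts \<psi>"]) (use f g D in \<open>auto simp: aut_def\<close>)
    ultimately show "fv = gv \<and> fd = gd"
      by simp
  qed
  moreover have "?h ` aut \<psi> \<phi>V \<phi>D = {a' \<in> occs n \<sigma>. same_image a a'}"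
  proof
    show "?h ` aut \<psi> \<phi>V \<phi>D \<subseteq> {a' \<in> occs n \<sigma>. same_image a a'}"
      using occs_comp_aut[OF a] by (auto simp del: restrict_apply)
    show "{a' \<in> occs n \<sigma>. same_image a a'} \<subseteq> ?h ` aut \<psi> \<phi>V \<phi>D"
    proof clarify
      fix a' assume "a' \<in> occs n \<sigma>" "same_image a a'"
      moreover from this have "a' \<in> labellings n"
        by (simp add: occs_def)
      ultimately obtain fv fd where "(fv, fd) \<in> aut \<psi> \<phi>V \<phi>D" "a' = ?h (fv, fd)"
        using same_image_imp_aut[OF L] by auto
      then show "a' \<in> ?h ` aut \<psi> \<phi>V \<phi>D"
        by (metis imageI)
    qed
  qed
  ultimately show ?thesis
    using card_image by fastforce
qed

lemma card_aut_pos: "card (aut \<psi> \<phi>V \<phi>D) > 0"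
proof -
  have "aut \<psi> \<phi>V \<phi>D \<subseteq> (verts \<psi> \<rightarrow>\<^sub>E verts \<psi>) \<times> (darts \<psi> \<rightarrow>\<^sub>E darts \<psi>)"
    by (auto simp: aut_def)
  then have "finite (aut \<psi> \<phi>V \<phi>D)"
    by (rule finite_subset) (simp add: finite_PiE finite_verts finite_darts)
  moreover have "(restrict id (verts \<psi>), restrict id (darts \<psi>)) \<in> aut \<psi> \<phi>V \<phi>D"
    using dart_props by (auto simp: aut_def is_morphism_def bij_betw_def)
  ultimately show ?thesis
    by (auto simp: card_gt_0_iff)
qed

section \<open>Pairs of occurrences with different images\<close>

definition distinct_pairs :: "nat \<Rightarrow> (('w \<Rightarrow> nat) \<times> ('w \<Rightarrow> nat)) set" where
  "distinct_pairs n = {(a, a'). a \<in> labellings n \<and> a' \<in> labellings n \<and> \<not> same_image a a'}"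

definition occ_pairs :: "nat \<Rightarrow> ('d \<Rightarrow> nat \<Rightarrow> nat) \<Rightarrow> (('w \<Rightarrow> nat) \<times> ('w \<Rightarrow> nat)) set" where
  "occ_pairs n \<sigma> = {(a, a'). a \<in> occs n \<sigma> \<and> a' \<in> occs n \<sigma> \<and> \<not> same_image a a'}"

lemma card_occs_bounds:
  assumes "occs n \<sigma> \<noteq> {}"
  shows "card (aut \<psi> \<phi>V \<phi>D) \<le> card (occs n \<sigma>)"
    and "card (occs n \<sigma>) \<le> card (aut \<psi> \<phi>V \<phi>D) + card (occ_pairs n \<sigma>)"
proof -
  let ?c = "card (aut \<psi> \<phi>V \<phi>D)" and ?X = "card (occs n \<sigma>)" and ?N = "card (occ_pairs n \<sigma>)"
  obtain a where a: "a \<in> occs n \<sigma>"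
    using assms by blast
  have "{a' \<in> occs n \<sigma>. same_image a a'} \<subseteq> occs n \<sigma>"
    by blast
  then show le: "?c \<le> ?X"
    using card_same_image[OF a] card_mono[OF finite_occs] by metis
  have "card {a' \<in> occs n \<sigma>. \<not> same_image b a'} = ?X - ?c" if b: "b \<in> occs n \<sigma>" for b
  proof -
    have "{a' \<in> occs n \<sigma>. \<not> same_image b a'} = occs n \<sigma> - {a' \<in> occs n \<sigma>. same_image b a'}"
      by blast
    then show ?thesis
      using card_same_image[OF b] finite_occs[of n \<sigma>] by (simp add: card_Diff_subset)
  qed
  moreover have "occ_pairs n \<sigma> = (SIGMA b:occs n \<sigma>. {a' \<in> occs n \<sigma>. \<not> same_image b a'})"
    by (auto simp: occ_pairs_def)
  \<comment> \<open>Each occurrence fails to share its image with exactly \<open>?X - ?c\<close>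
    others; as \<open>?X\<close> is positive, the product is at least
    \<open>?X - ?c\<close>.\<close>
  ultimately have "?N = ?X * (?X - ?c)"
    using finite_occs[of n \<sigma>] by (simp add: card_SigmaI)
  moreover have "?X > 0"
    using a finite_occs[of n \<sigma>] by (auto simp: card_gt_0_iff)
  ultimately have "?X - ?c \<le> ?N"
    by simp
  then show "?X \<le> ?c + ?N"
    by simp
qed

text \<open>\<open>D\<close> collects the darts that the second occurrence places inside the first
  image. Together with \<open>overlap a a'\<close> it is a proper subgraph of \<open>\<psi>\<close>,
  so the second image adds more new edges than new vertices.\<close>

lemma union_constraints_card:
  assumes "pruned \<psi>" "\<And>C. C \<in> components \<psi> \<Longrightarrow> comp_ord \<psi> C \<ge> 1"
    and a: "a \<in> labellings n" and a': "a' \<in> labellings n" and "\<not> same_image a a'"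
  obtains m where "card (constraints a \<union> constraints a') = 2 * m" "m \<le> 2 * num_edges"
    "m \<ge> num_edges + card (verts \<psi> - overlap a a') + 1"
proof -
  define D where "D = {d \<in> darts \<psi>. constraint a' d \<in> constraints a}"
  let ?F = "darts \<psi> - D"
  have D_rv: "rv \<psi> d \<in> D" if "d \<in> D" for d
  proof -
    have d: "d \<in> darts \<psi>"
      using that by (simp add: D_def)
    obtain e i j where eij: "constraint a' d = (e, i, j)"
      by (cases "constraint a' d") auto
    then have "(rv B e, j, i) \<in> constraints a"
      using that constraints_swap[of e i j a] by (simp add: D_def)
    then show ?thesis
      using constraint_rv[OF d, of a'] eij dart_props(3)[OF d] by (simp add: D_def)
  qed
  have D_tail: "tail \<psi> d \<in> overlap a a'" if dD: "d \<in> D" for d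
  proof -
    have d: "d \<in> darts \<psi>"
      using that by (simp add: D_def)
    obtain d1 where d1: "d1 \<in> darts \<psi>" "constraint a' d = constraint a d1"
      using dD by (auto simp: D_def)
    then have "lift a' (tail \<psi> d) = lift a (tail \<psi> d1)"
      using dart_props(8)[OF d] dart_props(8)[OF d1(1)] by (auto simp: constraint_def)
    then show ?thesis
      using dart_props(1)[OF d] dart_props(1)[OF d1(1)] unfolding overlap_def by blast
  qed
  have "\<not> (overlap a a' = verts \<psi> \<and> D = darts \<psi>)"
    using \<open>\<not> same_image a a'\<close> unfolding same_image_def overlap_def D_def by blast
  then have "2 * card (verts \<psi> - overlap a a') < card ?F"
    by (intro pruned_subgraph_deficit[OF wf_\<psi> assms(1,2)])
      (use D_rv D_tail in \<open>auto simp: overlap_def D_def\<close>)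
  moreover have "even (card ?F)"
  proof -
    have "rv \<psi> d \<in> ?F" if "d \<in> ?F" for d
      using that D_rv[of "rv \<psi> d"] dart_props(3,4)[of d] by auto
    \<comment> \<open>The missing darts are closed under reversal and so form a graph on the same
      vertices, which makes their number even.\<close>
    then have "wf_graph (\<psi>\<lparr>darts := ?F\<rparr>)"
      using wf_\<psi> by (auto simp: wf_graph_def)
    then show ?thesis
      using wf_graph_even_darts by fastforce
  qed
  then obtain f where f: "card ?F = 2 * f"
    by (elim evenE)
  moreover have "card (constraints a \<union> constraints a') = 2 * num_edges + card ?F"
  proof -
    have "constraints a \<union> constraints a' = constraints a \<union> constraint a' ` ?F"
      by (auto simp: D_def)
    moreover have "constraints a \<inter> constraint a' ` ?F = {}"
      by (auto simp: D_def)
    moreover have "card (constraint a' ` ?F) = card ?F"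
      using inj_on_constraint[OF a'] by (intro card_image) (auto intro: inj_on_subset)
    moreover have "card (constraints a) = 2 * num_edges"
      using card_image[OF inj_on_constraint[OF a]] card_darts by simp
    ultimately show ?thesis
      using finite_darts by (simp add: card_Un_disjoint)
  qed
  moreover have "card ?F \<le> 2 * num_edges"
    using card_mono[OF finite_darts, of ?F] card_darts by simp
  \<comment> \<open>With \<open>w\<close> vertices and \<open>f\<close> edges missing,
    \<open>2 * w < 2 * f\<close> sharpens to \<open>w + 1 \<le> f\<close>; this extra edge is the
    gain of a factor \<open>1/n\<close>.\<close>
  ultimately show ?thesis
    using that[of "num_edges + f"] by simp
qed

text \<open>A vertex in \<open>Q\<close> must take one of the at most
  \<open>card (verts \<psi>)\<close> labels used by \<open>a\<close>; any other vertex has at most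
  \<open>n\<close> choices.\<close>

lemma card_labellings_overlap:
  "card {a' \<in> labellings n. overlap a a' = Q} \<le> (card (verts \<psi>) + 1) ^ card (verts \<psi>) * n ^ card (verts \<psi> - Q)"
proof (cases "Q \<subseteq> verts \<psi>")
  case True
  let ?k = "card (verts \<psi>)"
  let ?P = "\<Pi>\<^sub>E v\<in>verts \<psi>. if v \<in> Q then a ` verts \<psi> else {..<n}"
  have "{a' \<in> labellings n. overlap a a' = Q} \<subseteq> ?P"
    by (auto simp: labellings_def overlap_def PiE_iff extensional_def)
  then have "card {a' \<in> labellings n. overlap a a' = Q} \<le> card ?P"
    using finite_verts by (intro card_mono finite_PiE) auto
  also have "\<dots> = (\<Prod>v\<in>verts \<psi>. card (if v \<in> Q then a ` verts \<psi> else {..<n}))"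
    using finite_verts by (rule card_PiE)
  also have "\<dots> = (\<Prod>v\<in>verts \<psi>. if v \<in> Q then card (a ` verts \<psi>) else n)"
    by (intro prod.cong) auto
  also have "\<dots> = card (a ` verts \<psi>) ^ card Q * n ^ card (verts \<psi> - Q)"
    using finite_verts True
    by (simp add: prod.If_cases Int_absorb1 Diff_eq)
  also have "\<dots> \<le> (?k + 1) ^ ?k * n ^ card (verts \<psi> - Q)"
  proof (intro mult_right_mono)
    have "card (a ` verts \<psi>) ^ card Q \<le> (?k + 1) ^ card Q"
      using card_image_le[OF finite_verts, of a] by (intro power_mono) auto
    \<comment> \<open>Adding 1 keeps the base at least 1, so that raising the exponent is monotone
      even without vertices.\<close>
    also have "\<dots> \<le> (?k + 1) ^ ?k"
      using True finite_verts by (intro power_increasing) (auto simp: card_mono)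
    finally show "card (a ` verts \<psi>) ^ card Q \<le> (?k + 1) ^ ?k" .
  qed simp
  finally show ?thesis .
next
  case False
  then have "{a' \<in> labellings n. overlap a a' = Q} = {}"
    by (auto simp: overlap_def)
  then show ?thesis
    by (simp only: card.empty zero_le)
qed

section \<open>Asymptotics\<close>

abbreviation "nv \<equiv> card (verts \<psi>)"

text \<open>This is \<open>n^(-r)\<close> for positive \<open>n\<close>, kept as a quotient of
  natural powers so that the estimates avoid \<open>powr\<close>.\<close>

definition scale :: "nat \<Rightarrow> real" where
  "scale n = real n ^ nv / real n ^ num_edges"

lemma scale_nonneg: "scale n \<ge> 0"
  by (simp add: scale_def)

lemma ord_eq: "real_of_int (ord \<psi>) = real num_edges - real nv"
  by (simp add: ord_def card_darts)

lemma powr_ord: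
  assumes "n > 0"
  shows "real n powr (- real_of_int (ord \<psi>)) = scale n"
    and "real n powr (- real_of_int (ord \<psi>) - 1) = scale n / real n"
proof -
  show *: "real n powr (- real_of_int (ord \<psi>)) = scale n"
    using assms by (simp add: ord_eq powr_diff powr_realpow scale_def)
  show "real n powr (- real_of_int (ord \<psi>) - 1) = scale n / real n"
    using assms * by (simp only: powr_diff) simp
qed

text \<open>The term with \<open>nv\<close> is the loss in counting labellings, and the term with
  \<open>num_edges\<close> the excess of their probability over
  \<open>1/n^num_edges\<close>.\<close>

lemma expected_occurs_approx:
  assumes "n > 2 * num_edges ^ 2" "n > num_edges" "n \<ge> nv"
  shows "\<bar>expected_occurs B \<psi> \<phi>V \<phi>D n - scale n\<bar> \<le> (real nv ^ 2 + 2 * real num_edges ^ 2) * (scale n / real n)"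
proof -
  let ?m = num_edges and ?E = "expected_occurs B \<psi> \<phi>V \<phi>D n"
  have n: "n > 0"
    using assms by simp
  have "?E \<le> real n ^ nv * (1 / (real n - ?m) ^ ?m)"
    using expected_occurs_bounds(1)[OF assms(2,3)] by simp
  also have "\<dots> \<le> real n ^ nv * ((1 + 2 * real ?m ^ 2 / real n) / real n ^ ?m)"
    using inverse_diff_power_le[OF assms(1)] by (intro mult_left_mono) auto
  also have "\<dots> = scale n + 2 * real ?m ^ 2 * (scale n / real n)"
    using n by (simp add: scale_def field_simps)
  finally have up: "?E \<le> scale n + 2 * real ?m ^ 2 * (scale n / real n)" .
  have "scale n - real nv ^ 2 * (scale n / real n) = (real n ^ nv * (1 - real nv ^ 2 / real n)) / real n ^ ?m"
    using n by (simp add: scale_def field_simps)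
  also have "\<dots> \<le> (real n - nv) ^ nv / real n ^ ?m"
    using diff_power_ge[OF assms(3) n] by (intro divide_right_mono) auto
  also have "\<dots> \<le> ?E"
    using expected_occurs_bounds(2)[OF assms(2,3)] by simp
  finally have low: "scale n - real nv ^ 2 * (scale n / real n) \<le> ?E" .
  have "0 \<le> real nv ^ 2 * (scale n / real n)" "0 \<le> 2 * real ?m ^ 2 * (scale n / real n)"
    using scale_nonneg by auto
  then show ?thesis
    using up low by (simp only: distrib_right abs_le_iff) linarith
qed

section \<open>From the expectation to the probability of occurrence\<close>

lemma prob_occurs_le_expected: "prob_occurs B \<psi> \<phi>V \<phi>D n \<le> expected_occurs B \<psi> \<phi>V \<phi>D n"
proof -
  have fin: "finite (cover_perms B n)"
    using card_cover_perms_pos[OF wf_B] by blast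
  let ?X = "\<lambda>\<sigma>. num_occurs \<psi> \<phi>V \<phi>D (cover_graph B n \<sigma>)"
  have "real (card {\<sigma> \<in> cover_perms B n. ?X \<sigma> > 0}) = (\<Sum>\<sigma>\<in>{\<sigma> \<in> cover_perms B n. ?X \<sigma> > 0}. 1)"
    by simp
  also have "\<dots> \<le> (\<Sum>\<sigma>\<in>{\<sigma> \<in> cover_perms B n. ?X \<sigma> > 0}. real (?X \<sigma>))"
    by (intro sum_mono) auto
  also have "\<dots> \<le> (\<Sum>\<sigma>\<in>cover_perms B n. real (?X \<sigma>))"
    using fin by (intro sum_mono2) auto
  finally show ?thesis
    unfolding prob_occurs_def expected_occurs_def by (intro divide_right_mono) auto
qed

text \<open>Averages over all covers of the pointwise bounds
  \<open>c [X > 0] \<le> X \<le> c [X > 0] + N\<close>, which hold trivially on the left and right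
  when \<open>X = 0\<close>.\<close>

lemma expected_minus_prob_bounds:
  defines "N \<equiv> \<lambda>n. real (\<Sum>\<sigma>\<in>cover_perms B n. card (occ_pairs n \<sigma>)) / card (cover_perms B n)"
    and "c \<equiv> real (card (aut \<psi> \<phi>V \<phi>D))"
  shows "c * prob_occurs B \<psi> \<phi>V \<phi>D n \<le> expected_occurs B \<psi> \<phi>V \<phi>D n"
    and "expected_occurs B \<psi> \<phi>V \<phi>D n \<le> c * prob_occurs B \<psi> \<phi>V \<phi>D n + N n"
proof -
  have fin: "finite (cover_perms B n)" and pos: "card (cover_perms B n) > 0"
    using card_cover_perms_pos[OF wf_B] by blast+
  let ?S = "cover_perms B n" and ?c = "card (aut \<psi> \<phi>V \<phi>D)"
  let ?p = "\<lambda>\<sigma>. if occs n \<sigma> \<noteq> {} then ?c else 0"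
  have "{\<sigma> \<in> ?S. num_occurs \<psi> \<phi>V \<phi>D (cover_graph B n \<sigma>) > 0} = {\<sigma> \<in> ?S. occs n \<sigma> \<noteq> {}}"
    using finite_occs by (auto simp: num_occurs_eq_card_occs card_gt_0_iff)
  then have P: "c * prob_occurs B \<psi> \<phi>V \<phi>D n = real (\<Sum>\<sigma>\<in>?S. ?p \<sigma>) / card ?S"
    using fin by (simp add: prob_occurs_def c_def sum.If_cases Int_def)
  have E: "expected_occurs B \<psi> \<phi>V \<phi>D n = real (\<Sum>\<sigma>\<in>?S. card (occs n \<sigma>)) / card ?S"
    by (simp add: expected_occurs_def num_occurs_eq_card_occs)
  have "(\<Sum>\<sigma>\<in>?S. ?p \<sigma>) \<le> (\<Sum>\<sigma>\<in>?S. card (occs n \<sigma>))"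
    by (intro sum_mono) (use card_occs_bounds(1) in auto)
  then show "c * prob_occurs B \<psi> \<phi>V \<phi>D n \<le> expected_occurs B \<psi> \<phi>V \<phi>D n"
    unfolding P E by (intro divide_right_mono) (simp_all only: of_nat_le_iff of_nat_0_le_iff)
  have "(\<Sum>\<sigma>\<in>?S. card (occs n \<sigma>)) \<le> (\<Sum>\<sigma>\<in>?S. ?p \<sigma> + card (occ_pairs n \<sigma>))"
    by (intro sum_mono) (use card_occs_bounds(2) in auto)
  also have "\<dots> = (\<Sum>\<sigma>\<in>?S. ?p \<sigma>) + (\<Sum>\<sigma>\<in>?S. card (occ_pairs n \<sigma>))"
    by (rule sum.distrib)
  finally have "real (\<Sum>\<sigma>\<in>?S. card (occs n \<sigma>)) / card ?S \<le>
      real ((\<Sum>\<sigma>\<in>?S. ?p \<sigma>) + (\<Sum>\<sigma>\<in>?S. card (occ_pairs n \<sigma>))) / card ?S"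
    by (intro divide_right_mono) (simp_all only: of_nat_le_iff of_nat_0_le_iff)
  then show "expected_occurs B \<psi> \<phi>V \<phi>D n \<le> c * prob_occurs B \<psi> \<phi>V \<phi>D n + N n"
    unfolding P E N_def by (simp only: of_nat_add add_divide_distrib)
qed

text \<open>The number \<open>m\<close> of prescribed edges varies with the pair but is at most
  \<open>2 * num_edges\<close>; hence one threshold for \<open>n\<close> serves all pairs, and
  beyond it the correction factor is at most 2.\<close>

lemma pair_probability_le:
  assumes "pruned \<psi>" "\<And>C. C \<in> components \<psi> \<Longrightarrow> comp_ord \<psi> C \<ge> 1"
    and a: "a \<in> labellings n" and a': "a' \<in> labellings n" and "\<not> same_image a a'"
    and n: "n > 2 * (2 * num_edges) ^ 2"
  shows "card (satisfying B n (constraints a \<union> constraints a')) / card (cover_perms B n)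
    \<le> 2 / real n ^ (num_edges + card (verts \<psi> - overlap a a') + 1)"
proof -
  obtain m where m: "card (constraints a \<union> constraints a') = 2 * m" "m \<le> 2 * num_edges"
    "m \<ge> num_edges + card (verts \<psi> - overlap a a') + 1"
    using union_constraints_card[OF assms(1-5)] by blast
  have "m ^ 2 \<le> (2 * num_edges) ^ 2"
    using m(2) by (intro power_mono) auto
  then have nm: "n > 2 * m ^ 2"
    using n by linarith
  have mn: "m < n"
    using nm by (cases m) (auto simp: power2_eq_square)
  have N: "real (card (cover_perms B n)) > 0"
    using card_cover_perms_pos[OF wf_B] by simp
  let ?s = "card (satisfying B n (constraints a \<union> constraints a'))"
  have "(n - m) ^ m * ?s \<le> card (cover_perms B n)"
  proof (rule card_satisfying_bounds(1)[OF wf_B _ _ m(1)])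
    show "constraints a \<union> constraints a' \<subseteq> darts B \<times> {..<n} \<times> {..<n}"
      using constraints_subset[OF a] constraints_subset[OF a'] by simp
    show "(rv B e, j, i) \<in> constraints a \<union> constraints a'"
      if "(e, i, j) \<in> constraints a \<union> constraints a'" for e i j
      using that constraints_swap[of e i j a] constraints_swap[of e i j a'] by blast
  qed
  then have "real ((n - m) ^ m * ?s) \<le> card (cover_perms B n)"
    by (simp only: of_nat_le_iff)
  then have "(real n - m) ^ m * ?s \<le> card (cover_perms B n)"
    using mn by (simp add: of_nat_diff)
  then have "?s / card (cover_perms B n) \<le> 1 / (real n - m) ^ m"
    using N mn by (simp add: field_simps)
  also have "\<dots> \<le> (1 + 2 * real m ^ 2 / real n) / real n ^ m"
    by (rule inverse_diff_power_le[OF nm])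
  also have "\<dots> \<le> 2 / real n ^ m"
  proof (rule divide_right_mono)
    have "real (2 * m ^ 2) \<le> real n"
      using nm by (simp only: of_nat_le_iff)
    then show "1 + 2 * real m ^ 2 / real n \<le> 2"
      using mn by (simp add: field_simps)
  qed simp
  also have "\<dots> \<le> 2 / real n ^ (num_edges + card (verts \<psi> - overlap a a') + 1)"
    using m(3) mn by (intro divide_left_mono power_increasing) auto
  finally show ?thesis .
qed

lemma expected_occ_pairs_le:
  assumes "pruned \<psi>" "\<And>C. C \<in> components \<psi> \<Longrightarrow> comp_ord \<psi> C \<ge> 1"
    and n: "n > 2 * (2 * num_edges) ^ 2"
  shows "real (\<Sum>\<sigma>\<in>cover_perms B n. card (occ_pairs n \<sigma>)) / card (cover_perms B n)
    \<le> 2 ^ nv * (2 * real ((nv + 1) ^ nv)) * (scale n / real n)"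
proof -
  let ?N = "real (card (cover_perms B n))"
  let ?w = "\<lambda>Q. 2 / real n ^ (num_edges + card (verts \<psi> - Q) + 1)"
  let ?K = "real ((nv + 1) ^ nv)"
  have n0: "n > 0"
    using n by simp
  have sub: "distinct_pairs n \<subseteq> labellings n \<times> labellings n"
    by (auto simp: distinct_pairs_def)
  then have fin: "finite (distinct_pairs n)"
    using finite_labellings finite_subset by blast
  have finp: "finite (occ_pairs n \<sigma>)" for \<sigma>
    by (rule finite_subset[of _ "occs n \<sigma> \<times> occs n \<sigma>"]) (auto simp: occ_pairs_def finite_occs)
  have "(\<Sum>\<sigma>\<in>cover_perms B n. card (occ_pairs n \<sigma>)) =
      (\<Sum>p\<in>distinct_pairs n. card (satisfying B n (constraints (fst p) \<union> constraints (snd p))))"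
  proof (rule sum_card_eq_sum_satisfying[OF finp fin])
    fix \<sigma> p assume "\<sigma> \<in> cover_perms B n"
    then show "p \<in> occ_pairs n \<sigma> \<longleftrightarrow>
        p \<in> distinct_pairs n \<and> \<sigma> \<in> satisfying B n (constraints (fst p) \<union> constraints (snd p))"
      by (cases p) (auto simp: occ_pairs_def distinct_pairs_def occs_iff_satisfying in_satisfying_iff)
  qed
  then have "real (\<Sum>\<sigma>\<in>cover_perms B n. card (occ_pairs n \<sigma>)) / ?N =
      (\<Sum>p\<in>distinct_pairs n. card (satisfying B n (constraints (fst p) \<union> constraints (snd p))) / ?N)"
    by (simp add: sum_divide_distrib)
  also have "\<dots> \<le> (\<Sum>p\<in>distinct_pairs n. ?w (overlap (fst p) (snd p)))"
    by (intro sum_mono pair_probability_le assms) (auto simp: distinct_pairs_def)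
  \<comment> \<open>The weights are nonnegative and already contain the extra factor
    \<open>1/n\<close>, so admitting all pairs keeps the required order.\<close>
  also have "\<dots> \<le> (\<Sum>p\<in>labellings n \<times> labellings n. ?w (overlap (fst p) (snd p)))"
    using sub finite_labellings by (intro sum_mono2) auto
  also have "\<dots> = (\<Sum>a\<in>labellings n. \<Sum>a'\<in>labellings n. ?w (overlap a a'))"
    by (simp add: sum.cartesian_product case_prod_beta)
  also have "\<dots> \<le> (\<Sum>a\<in>labellings n. 2 ^ nv * (2 * ?K / real n ^ (num_edges + 1)))"
  proof (rule sum_mono)
    fix a
    \<comment> \<open>Grouping by the overlap \<open>Q\<close> makes the count of second labellings,
      of order \<open>n^card (verts \<psi> - Q)\<close>, cancel against the weight. What is left is
      the same for each of the \<open>2^nv\<close> sets \<open>Q\<close>.\<close>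
    have "(\<Sum>a'\<in>labellings n. ?w (overlap a a')) =
        (\<Sum>Q\<in>Pow (verts \<psi>). \<Sum>a'\<in>{a' \<in> labellings n. overlap a a' = Q}. ?w (overlap a a'))"
      using finite_labellings finite_verts
      by (intro sum.group[symmetric]) (auto simp: overlap_def)
    also have "\<dots> = (\<Sum>Q\<in>Pow (verts \<psi>). card {a' \<in> labellings n. overlap a a' = Q} * ?w Q)"
      by (intro sum.cong) auto
    also have "\<dots> \<le> (\<Sum>Q\<in>Pow (verts \<psi>). 2 * ?K / real n ^ (num_edges + 1))"
    proof (rule sum_mono)
      fix Q
      have "real (card {a' \<in> labellings n. overlap a a' = Q}) \<le> real ((nv + 1) ^ nv * n ^ card (verts \<psi> - Q))"
        using card_labellings_overlap[of n a Q] by (simp only: of_nat_le_iff)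
      then have "card {a' \<in> labellings n. overlap a a' = Q} * ?w Q
          \<le> real ((nv + 1) ^ nv * n ^ card (verts \<psi> - Q)) * ?w Q"
        by (intro mult_right_mono) auto
      also have "\<dots> = 2 * ?K / real n ^ (num_edges + 1)"
        using n0 by (simp add: power_add)
      finally show "card {a' \<in> labellings n. overlap a a' = Q} * ?w Q \<le> 2 * ?K / real n ^ (num_edges + 1)" .
    qed
    also have "\<dots> = 2 ^ nv * (2 * ?K / real n ^ (num_edges + 1))"
      using finite_verts by (simp add: card_Pow)
    finally show "(\<Sum>a'\<in>labellings n. ?w (overlap a a')) \<le> 2 ^ nv * (2 * ?K / real n ^ (num_edges + 1))" .
  qed
  also have "\<dots> = real (card (labellings n)) * (2 ^ nv * (2 * ?K / real n ^ (num_edges + 1)))"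
    by simp
  also have "\<dots> \<le> real (n ^ nv) * (2 ^ nv * (2 * ?K / real n ^ (num_edges + 1)))"
    using card_labellings_le[of n] by (intro mult_right_mono) (simp_all only: of_nat_le_iff, simp)
  also have "\<dots> = 2 ^ nv * (2 * ?K) * (scale n / real n)"
    by (simp add: scale_def mult_ac)
  finally show ?thesis .
qed

lemma expected_occurs_asymptotics:
  "(\<lambda>n. expected_occurs B \<psi> \<phi>V \<phi>D n - real n powr (- real_of_int (ord \<psi>)))
     \<in> O(\<lambda>n. real n powr (- real_of_int (ord \<psi>) - 1))"
proof (rule bigoI)
  show "\<forall>\<^sub>F n in at_top. norm (expected_occurs B \<psi> \<phi>V \<phi>D n - real n powr (- real_of_int (ord \<psi>)))
      \<le> (real nv ^ 2 + 2 * real num_edges ^ 2) * norm (real n powr (- real_of_int (ord \<psi>) - 1))"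
    using eventually_gt_at_top[of "2 * num_edges ^ 2"] eventually_gt_at_top[of num_edges]
      eventually_ge_at_top[of nv]
  proof eventually_elim
    case (elim n)
    then have "n > 0"
      by simp
    then show ?case
      using expected_occurs_approx[OF elim] scale_nonneg[of n] by (simp only: powr_ord) simp
  qed
qed

lemma prob_occurs_asymptotics:
  assumes "pruned \<psi>" "\<And>C. C \<in> components \<psi> \<Longrightarrow> comp_ord \<psi> C \<ge> 1"
  shows "(\<lambda>n. prob_occurs B \<psi> \<phi>V \<phi>D n - real n powr (- real_of_int (ord \<psi>)) / real (card (aut \<psi> \<phi>V \<phi>D)))
     \<in> O(\<lambda>n. real n powr (- real_of_int (ord \<psi>) - 1))"
proof (rule bigoI)
  let ?c = "real (card (aut \<psi> \<phi>V \<phi>D))"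
  let ?K = "2 ^ nv * (2 * real ((nv + 1) ^ nv))" and ?L = "real nv ^ 2 + 2 * real num_edges ^ 2"
  have c: "?c \<ge> 1"
    using card_aut_pos by simp
  show "\<forall>\<^sub>F n in at_top. norm (prob_occurs B \<psi> \<phi>V \<phi>D n - real n powr (- real_of_int (ord \<psi>)) / ?c)
      \<le> (?K + ?L) * norm (real n powr (- real_of_int (ord \<psi>) - 1))"
    using eventually_gt_at_top[of "2 * (2 * num_edges) ^ 2"] eventually_gt_at_top[of num_edges]
      eventually_ge_at_top[of nv]
  proof eventually_elim
    case (elim n)
    let ?P = "prob_occurs B \<psi> \<phi>V \<phi>D n" and ?E = "expected_occurs B \<psi> \<phi>V \<phi>D n"
    have n: "n > 0"
      using elim by simp
    \<comment> \<open>The threshold chosen for pairs, \<open>8 * num_edges^2\<close>, exceeds the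
      one that the expectation requires.\<close>
    have "\<bar>?E - scale n\<bar> \<le> ?L * (scale n / real n)"
      using elim by (intro expected_occurs_approx) (auto simp: power_mult_distrib)
    moreover have "?c * ?P \<le> ?E" "?E \<le> ?c * ?P + ?K * (scale n / real n)"
      using expected_minus_prob_bounds[of n] expected_occ_pairs_le[OF assms elim(1)] by simp_all
    ultimately have *: "\<bar>?c * ?P - scale n\<bar> \<le> (?K + ?L) * (scale n / real n)"
      by (simp only: distrib_right abs_le_iff) linarith
    have "\<bar>?P - scale n / ?c\<bar> = \<bar>?c * ?P - scale n\<bar> / ?c"
    proof -
      have "?P - scale n / ?c = (?c * ?P - scale n) / ?c"
        using c by (simp add: field_simps)
      then show ?thesis
        by simp
    qed
    \<comment> \<open>Dividing by \<open>?c \<ge> 1\<close> does not enlarge the error, so the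
      constant need not involve \<open>?c\<close>.\<close>
    also have "\<dots> \<le> \<bar>?c * ?P - scale n\<bar>"
      using c by (simp add: divide_le_eq mult_le_cancel_left1)
    also have "\<dots> \<le> (?K + ?L) * (scale n / real n)"
      by (rule *)
    finally show ?case
      using scale_nonneg[of n] n by (simp only: powr_ord) simp
  qed
qed

end

theorem theorem2p51:
  fixes B :: "('v, 'd) graph" and \<psi> :: "('w, 'e) graph"
    and \<phi>V :: "'w \<Rightarrow> 'v" and \<phi>D :: "'e \<Rightarrow> 'd"
  assumes "wf_graph B" and "wf_graph \<psi>"
    and "etale \<psi> B \<phi>V \<phi>D"
  defines "r \<equiv> ord \<psi>"
  shows "((\<lambda>n. expected_occurs B \<psi> \<phi>V \<phi>D n - real n powr (- real_of_int r))
             \<in> O(\<lambda>n. real n powr (- real_of_int r - 1)))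
       \<and> (\<exists>g. g \<in> O(\<lambda>n. real n powr (- real_of_int r - 1)) \<and>
             (\<forall>\<^sub>F n in at_top. prob_occurs B \<psi> \<phi>V \<phi>D n \<le> real n powr (- real_of_int r) + g n))
       \<and> (pruned \<psi> \<and> (\<forall>C \<in> components \<psi>. comp_ord \<psi> C \<ge> 1) \<longrightarrow>
             (\<lambda>n. prob_occurs B \<psi> \<phi>V \<phi>D n
                   - real n powr (- real_of_int r) / real (card (aut \<psi> \<phi>V \<phi>D)))
             \<in> O(\<lambda>n. real n powr (- real_of_int r - 1)))"
proof -
  interpret etale_morphism B \<psi> \<phi>V \<phi>D
    using assms(1-3) by unfold_locales
  \<comment> \<open>The error term of the expectation also serves as error term of the upper bound,
    because the probability is at most the expectation.\<close>
  let ?g = "\<lambda>n. expected_occurs B \<psi> \<phi>V \<phi>D n - real n powr (- real_of_int r)"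
  have g: "?g \<in> O(\<lambda>n. real n powr (- real_of_int r - 1))"
    unfolding r_def by (rule expected_occurs_asymptotics)
  have "\<forall>\<^sub>F n in at_top. prob_occurs B \<psi> \<phi>V \<phi>D n \<le> real n powr (- real_of_int r) + ?g n"
    using prob_occurs_le_expected by simp
  with g show ?thesis
    using prob_occurs_asymptotics unfolding r_def[symmetric] by blast
qed

end
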